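(* Let $r,s\in\mathbb{N}_0=\{0,1,2,\dots\}$. Then the following equality holds in $\mathbb{Z}\llbracket x_1,\dots,x_r,q_1,\dots,q_s,y\rrbracket$ (in particular, both sides have integer coefficients): $$1+\sum_{n\geq1}\frac{y^{n}}{n!}\sum_{\sigma\in S_{n}}\frac{\prod_{j=1}^{r}\det(I_{n}-x_{j}M_{\sigma})}{\prod_{k=1}^{s}\det(I_{n}-q_{k}M_{\sigma})}=\prod_{\mathbf{j}\in\{0,1\}^{r}}\ \prod_{\mathbf{k}\in\mathbb{N}_{0}^{s}}\left(1-y\,\mathbf{x}^{\mathbf{j}}\,\mathbf{q}^{\mathbf{k}}\right)^{(-1)^{|\mathbf{j}|+1}},$$ where $|\mathbf{j}|=\sum_{i=1}^{r}j_i$.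
   Context: $S_n$ is the symmetric group on $n$ letters, $M_\sigma$ is the $n\times n$ permutation matrix of $\sigma\in S_n$, and $I_n$ is the $n\times n$ identity matrix. Multi-index notation: for $\mathbf{j}=(j_1,\dots,j_r)$ and $\mathbf{k}=(k_1,\dots,k_s)$, $\mathbf{x}^{\mathbf{j}}=x_1^{j_1}\cdots x_r^{j_r}$ and $\mathbf{q}^{\mathbf{k}}=q_1^{k_1}\cdots q_s^{k_s}$. Empty products equal $1$ (and when $r=0$ or $s=0$ the corresponding index set consists of a single empty tuple). Each $\det(I_n-q_kM_\sigma)$ has constant term $1$, so it is invertible as a formal power series. The infinite product is understood as a (convergent) product of formal power series. *)

theory Defs
  imports
    "Jordan_Normal_Form.Determinant"
    "HOL-Analysis.Infinite_Sum"
    "HOL-Library.FuncSet"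
    "HOL-Library.Multiset"
begin

section \<open>Formal power series in several commuting variables\<close>

text \<open>
  A monomial in the variables \<open>'v\<close> is a multiset over \<open>'v\<close>: the exponent of \<open>v\<close> is its
  multiplicity, and multiplication of monomials is multiset sum.  A power series is an arbitrary
  family of coefficients indexed by the monomials.
\<close>

typedef ('v, 'a) mps = "UNIV :: ('v multiset \<Rightarrow> 'a) set"
  morphisms mps_coeff Abs_mps ..

lemma mps_coeff_Abs [simp]: "mps_coeff (Abs_mps f) = f"
  by (simp add: Abs_mps_inverse)

lemma mps_eqI: "(\<And>m. mps_coeff f m = mps_coeff g m) \<Longrightarrow> f = g"
  by (simp add: ext mps_coeff_inject[symmetric])

definition mps_var :: "'v \<Rightarrow> ('v, 'a::zero_neq_one) mps" where
  "mps_var v = Abs_mps (\<lambda>m. if m = {#v#} then 1 else 0)"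

definition mps_of_int :: "('v, int) mps \<Rightarrow> ('v, 'a::ring_1) mps" where
  "mps_of_int f = Abs_mps (\<lambda>m. of_int (mps_coeff f m))"

text \<open>The subring of the series that involve only variables from \<open>V\<close>.\<close>

definition mps_over :: "'v set \<Rightarrow> ('v, 'a::zero) mps set" where
  "mps_over V = {f. \<forall>m. mps_coeff f m \<noteq> 0 \<longrightarrow> set_mset m \<subseteq> V}"


subsection \<open>Ring structure\<close>

lemma finite_mset_splits: "finite {(a, b). a + b = (m :: 'v multiset)}"
proof (induction m)
  case (add x m)
  let ?S = "{(a, b). a + b = m}"
  have "{(a, b). a + b = add_mset x m} \<subseteq>
      (\<lambda>(a, b). (add_mset x a, b)) ` ?S \<union> (\<lambda>(a, b). (a, add_mset x b)) ` ?S"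
  proof clarify
    fix a b
    assume ab: "a + b = add_mset x m"
      and notR: "(a, b) \<notin> (\<lambda>(a, b). (a, add_mset x b)) ` ?S"
    show "(a, b) \<in> (\<lambda>(a, b). (add_mset x a, b)) ` ?S"
    proof (cases "x \<in># a")
      case True
      then obtain a' where "a = add_mset x a'" by (meson multi_member_split)
      with ab show ?thesis by force
    next
      case False
      with ab have "x \<in># b" by (metis union_iff union_single_eq_member)
      then obtain b' where "b = add_mset x b'" by (meson multi_member_split)
      with ab notR show ?thesis by force
    qed
  qed
  then show ?case by (rule finite_subset) (use add in auto)
qed simp

instantiation mps :: (type, comm_ring_1) comm_ring_1
begin

definition "0 = Abs_mps (\<lambda>_. 0)"
definition "1 = Abs_mps (\<lambda>m. if m = {#} then 1 else 0)"
definition "f + g = Abs_mps (\<lambda>m. mps_coeff f m + mps_coeff g m)"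
definition "- f = Abs_mps (\<lambda>m. - mps_coeff f m)"
definition "f - g = Abs_mps (\<lambda>m. mps_coeff f m - mps_coeff g m)"
definition "f * g = Abs_mps (\<lambda>m. \<Sum>(a, b) | a + b = m. mps_coeff f a * mps_coeff g b)"

instance
proof
  fix f g h :: "('a, 'b) mps"
  show "f * g * h = f * (g * h)"
  proof (rule mps_eqI)
    fix m
    let ?c = "mps_coeff f" and ?d = "mps_coeff g" and ?e = "mps_coeff h"
    let ?S = "\<lambda>m. {(a, b). a + b = (m :: 'a multiset)}"
    have "mps_coeff (f * g * h) m =
        (\<Sum>p\<in>?S m. \<Sum>q\<in>?S (fst p). ?c (fst q) * ?d (snd q) * ?e (snd p))"
      by (simp add: times_mps_def sum_distrib_right case_prod_beta)
    also have "\<dots> = (\<Sum>(p, q)\<in>Sigma (?S m) (\<lambda>p. ?S (fst p)).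
        ?c (fst q) * ?d (snd q) * ?e (snd p))"
      by (rule sum.Sigma) (auto intro: finite_mset_splits)
    also have "\<dots> = (\<Sum>(p, q)\<in>Sigma (?S m) (\<lambda>p. ?S (snd p)).
        ?c (fst p) * (?d (fst q) * ?e (snd q)))"
      by (rule sum.reindex_bij_witness[where
            i = "\<lambda>(p, q). ((fst p + fst q, snd q), (fst p, fst q))" and
            j = "\<lambda>(p, q). ((fst q, snd q + snd p), (snd q, snd p))"])
        (auto simp: mult.assoc add.assoc)
    also have "\<dots> = (\<Sum>p\<in>?S m. \<Sum>q\<in>?S (snd p). ?c (fst p) * (?d (fst q) * ?e (snd q)))"
      by (rule sum.Sigma[symmetric]) (auto intro: finite_mset_splits)
    also have "\<dots> = mps_coeff (f * (g * h)) m"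
      by (simp add: times_mps_def sum_distrib_left case_prod_beta)
    finally show "mps_coeff (f * g * h) m = mps_coeff (f * (g * h)) m" .
  qed
  show "f * g = g * f"
    unfolding times_mps_def
    by (rule arg_cong[where f = Abs_mps], rule ext,
        rule sum.reindex_bij_witness[where i = prod.swap and j = prod.swap])
      (auto simp: add.commute mult.commute)
  show "1 * f = f"
  proof (rule mps_eqI)
    fix m
    have "mps_coeff (1 * f) m =
        (\<Sum>p\<in>{(a, b). a + b = m}. if p = ({#}, m) then mps_coeff f m else 0)"
      unfolding times_mps_def one_mps_def by (auto intro!: sum.cong)
    also have "\<dots> = mps_coeff f m"
      by (subst sum.delta) (auto simp: finite_mset_splits)
    finally show "mps_coeff (1 * f) m = mps_coeff f m" .
  qed
  show "(f + g) * h = f * h + g * h"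
    by (rule mps_eqI)
      (simp add: times_mps_def plus_mps_def case_prod_beta distrib_right sum.distrib)
  show "(0 :: ('a, 'b) mps) \<noteq> 1"
  proof
    assume "(0 :: ('a, 'b) mps) = 1"
    then have "mps_coeff (0 :: ('a, 'b) mps) {#} = mps_coeff 1 {#}" by (rule arg_cong)
    then show False by (simp add: zero_mps_def one_mps_def)
  qed
qed (auto intro!: mps_eqI
      simp: plus_mps_def zero_mps_def uminus_mps_def minus_mps_def algebra_simps)

end

text \<open>As usual, \<open>inverse f\<close> is only meaningful if \<open>f\<close> is a unit.\<close>

instantiation mps :: (type, comm_ring_1) inverse
begin

definition "inverse f = (if \<exists>g. f * g = 1 then THE g. f * g = 1 else (0 :: ('a, 'b) mps))"
definition "f div g = f * inverse (g :: ('a, 'b) mps)"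

instance ..

end

lemma mps_inverse_unique:
  fixes f g :: "('v, 'a::comm_ring_1) mps"
  assumes "f * g = 1"
  shows "inverse f = g"
proof -
  have "h = g" if "f * h = 1" for h
  proof -
    have "h = (f * g) * h" by (simp add: assms)
    also have "\<dots> = g * (f * h)" by (simp add: mult_ac)
    finally show ?thesis by (simp add: that)
  qed
  then have "(THE h. f * h = 1) = g"
    by (rule the_equality[where P = "\<lambda>h. f * h = 1", OF assms])
  moreover have "\<exists>h. f * h = 1"
    using assms by (rule exI)
  ultimately show ?thesis
    by (simp only: inverse_mps_def if_True)
qed


subsection \<open>Topology of coefficientwise convergence\<close>

text \<open>
  This is the product topology for discrete coefficients.  On series in finitely many variables
  it agrees with the adic topology of the ideal generated by these variables.
\<close>

instantiation mps :: (type, type) t2_space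
begin

definition "open U \<longleftrightarrow>
  (\<forall>f\<in>U. \<exists>M. finite M \<and>
     (\<forall>g. (\<forall>m\<in>M. mps_coeff g m = mps_coeff f m) \<longrightarrow> g \<in> (U :: ('a, 'b) mps set)))"

instance
proof
  show "open (UNIV :: ('a, 'b) mps set)"
    unfolding open_mps_def by blast
next
  fix S T :: "('a, 'b) mps set"
  assume ST: "open S" "open T"
  show "open (S \<inter> T)"
    unfolding open_mps_def
  proof
    fix f assume f: "f \<in> S \<inter> T"
    obtain M where M: "finite M"
      "\<And>g. (\<forall>m\<in>M. mps_coeff g m = mps_coeff f m) \<Longrightarrow> g \<in> S"
      using ST(1) f unfolding open_mps_def by blast
    obtain N where N: "finite N"
      "\<And>g. (\<forall>m\<in>N. mps_coeff g m = mps_coeff f m) \<Longrightarrow> g \<in> T"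
      using ST(2) f unfolding open_mps_def by blast
    show "\<exists>M. finite M \<and> (\<forall>g. (\<forall>m\<in>M. mps_coeff g m = mps_coeff f m) \<longrightarrow> g \<in> S \<inter> T)"
      by (rule exI[of _ "M \<union> N"]) (simp add: M N)
  qed
next
  fix K :: "('a, 'b) mps set set"
  assume K: "\<forall>S\<in>K. open S"
  show "open (\<Union>K)"
    unfolding open_mps_def
  proof
    fix f assume "f \<in> \<Union>K"
    then obtain S where S: "S \<in> K" "f \<in> S" by blast
    with K have "open S" by blast
    with S(2) obtain M where "finite M"
      "\<forall>g. (\<forall>m\<in>M. mps_coeff g m = mps_coeff f m) \<longrightarrow> g \<in> S"
      unfolding open_mps_def by blast
    with S(1) show "\<exists>M. finite M \<and> (\<forall>g. (\<forall>m\<in>M. mps_coeff g m = mps_coeff f m) \<longrightarrow> g \<in> \<Union>K)"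
      by (intro exI[of _ M]) auto
  qed
next
  fix f g :: "('a, 'b) mps"
  assume "f \<noteq> g"
  have "\<exists>m. mps_coeff f m \<noteq> mps_coeff g m"
  proof (rule ccontr)
    assume "\<nexists>m. mps_coeff f m \<noteq> mps_coeff g m"
    then have "f = g" by (intro mps_eqI) simp
    with \<open>f \<noteq> g\<close> show False by contradiction
  qed
  then obtain m where m: "mps_coeff f m \<noteq> mps_coeff g m" ..
  have op: "open {h :: ('a, 'b) mps. mps_coeff h m = c}" for c
    unfolding open_mps_def by (intro ballI exI[of _ "{m}"]) simp
  show "\<exists>U V. open U \<and> open V \<and> f \<in> U \<and> g \<in> V \<and> U \<inter> V = {}"
  proof (intro exI conjI)
    show "open {h :: ('a, 'b) mps. mps_coeff h m = mps_coeff f m}"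
      "open {h :: ('a, 'b) mps. mps_coeff h m = mps_coeff g m}"
      by (rule op)+
  qed (use m in auto)
qed

end


section \<open>Unordered infinite products\<close>

text \<open>The multiplicative counterparts of \<^const>\<open>has_sum\<close>, \<^const>\<open>summable_on\<close> and \<^const>\<open>infsum\<close>.\<close>

definition has_infprod ::
    "('i \<Rightarrow> 'a::{comm_monoid_mult, topological_space}) \<Rightarrow> 'a \<Rightarrow> 'i set \<Rightarrow> bool" where
  "has_infprod f P A \<longleftrightarrow> (prod f \<longlongrightarrow> P) (finite_subsets_at_top A)"

definition multipliable_on ::
    "('i \<Rightarrow> 'a::{comm_monoid_mult, topological_space}) \<Rightarrow> 'i set \<Rightarrow> bool" where
  "multipliable_on f A \<longleftrightarrow> (\<exists>P. has_infprod f P A)"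

definition infprod :: "('i \<Rightarrow> 'a::{comm_monoid_mult, t2_space}) \<Rightarrow> 'i set \<Rightarrow> 'a" where
  "infprod f A = (if multipliable_on f A then Lim (finite_subsets_at_top A) (prod f) else 1)"


section \<open>Permutation matrices and the variables\<close>

text \<open>
  The letters are \<open>0, \<dots>, n - 1\<close>, matching the matrix indices; column \<open>j\<close> of \<open>M\<^sub>\<sigma>\<close> is the
  standard basis vector with index \<open>\<sigma> j\<close>.
\<close>

definition perm_matrix :: "nat \<Rightarrow> (nat \<Rightarrow> nat) \<Rightarrow> 'a::{zero, one} mat" where
  "perm_matrix n \<sigma> = mat n n (\<lambda>(i, j). if i = \<sigma> j then 1 else 0)"

datatype var = VarX nat | VarQ nat | VarY

abbreviation X :: "nat \<Rightarrow> (var, 'a::zero_neq_one) mps" where "X j \<equiv> mps_var (VarX j)"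
abbreviation Q :: "nat \<Rightarrow> (var, 'a::zero_neq_one) mps" where "Q k \<equiv> mps_var (VarQ k)"
abbreviation Y :: "(var, 'a::zero_neq_one) mps" where "Y \<equiv> mps_var VarY"

definition vars :: "nat \<Rightarrow> nat \<Rightarrow> var set" where
  "vars r s = VarX ` {1..r} \<union> VarQ ` {1..s} \<union> {VarY}"

end

theory Submission
  imports Defs
begin

text \<open>
  Give every letter a weight and replace the entries \<open>x\<close> of \<open>x M\<^sub>\<sigma>\<close> by powers of \<open>x\<close> with these
  weights as exponents.  Eliminating the last letter from the determinant either splits off a
  factor \<open>1 - x ^ e\<close> (fixed point) or adds its weight \<open>e\<close> to that of another letter.  Iterating this
  from weight one shows that the averages \<open>a\<^sub>n\<close> on the left satisfy Newton's recursion
  \<open>n a\<^sub>n = p\<^sub>1 a\<^sub>n\<^sub>-\<^sub>1 + \<dots> + p\<^sub>n a\<^sub>0\<close> with \<open>p\<^sub>k = (\<Prod>\<^sub>j 1 - x\<^sub>j ^ k) / (\<Prod>\<^sub>i 1 - q\<^sub>i ^ k)\<close>,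
  without any reference to cycle types.
  Hence \<open>E = \<Sum>\<^sub>n a\<^sub>n y ^ n\<close> solves \<open>y E' = E (\<Sum>\<^sub>k p\<^sub>k y ^ k)\<close>.  Expanding \<open>p\<^sub>k\<close> into signed \<open>k\<close>-th powers of
  the monomials in \<open>x, q\<close> shows that the product on the right solves the same equation, and both
  sides are \<open>1\<close> at \<open>y = 0\<close>.  Infinite sums and products are handled by comparing the coefficients
  of total degree at most \<open>N\<close>.
\<close>


section \<open>Truncation of power series\<close>

lemma mps_coeff_ring [simp]:
  fixes f g :: "('v, 'a::comm_ring_1) mps"
  shows "mps_coeff (0 :: ('v, 'a) mps) m = 0"
    and "mps_coeff (1 :: ('v, 'a) mps) m = (if m = {#} then 1 else 0)"
    and "mps_coeff (f + g) m = mps_coeff f m + mps_coeff g m"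
    and "mps_coeff (f - g) m = mps_coeff f m - mps_coeff g m"
    and "mps_coeff (- f) m = - mps_coeff f m"
  by (simp_all add: zero_mps_def one_mps_def plus_mps_def minus_mps_def uminus_mps_def)

lemma mps_coeff_mult:
  fixes f g :: "('v, 'a::comm_ring_1) mps"
  shows "mps_coeff (f * g) m = (\<Sum>(a, b) | a + b = m. mps_coeff f a * mps_coeff g b)"
  by (simp add: times_mps_def)

lemma mps_coeff_var:
  "mps_coeff (mps_var v :: ('v, 'a::zero_neq_one) mps) m = (if m = {#v#} then 1 else 0)"
  by (simp add: mps_var_def)

text \<open>Congruence modulo the ideal of series without terms of degree at most \<open>N\<close>.
  Every limit below is handled through these congruences, which respect the ring operations.\<close>

definition eq_upto :: "nat \<Rightarrow> ('v, 'a) mps \<Rightarrow> ('v, 'a) mps \<Rightarrow> bool" where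
  "eq_upto N f g \<longleftrightarrow> (\<forall>m. size m \<le> N \<longrightarrow> mps_coeff f m = mps_coeff g m)"

lemma eq_upto_refl [simp]: "eq_upto N f f"
  and eq_upto_sym: "eq_upto N f g \<Longrightarrow> eq_upto N g f"
  and eq_upto_trans [trans]: "eq_upto N f g \<Longrightarrow> eq_upto N g h \<Longrightarrow> eq_upto N f h"
  by (auto simp: eq_upto_def)

lemma eq_upto_imp_eq: "(\<And>N. eq_upto N f g) \<Longrightarrow> f = g"
  by (rule mps_eqI) (auto simp: eq_upto_def)

lemma eq_upto_add:
  fixes f g :: "('v, 'a::comm_ring_1) mps"
  shows "eq_upto N f f' \<Longrightarrow> eq_upto N g g' \<Longrightarrow> eq_upto N (f + g) (f' + g')"
  by (auto simp: eq_upto_def)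

lemma eq_upto_diff:
  fixes f g :: "('v, 'a::comm_ring_1) mps"
  shows "eq_upto N f f' \<Longrightarrow> eq_upto N g g' \<Longrightarrow> eq_upto N (f - g) (f' - g')"
  by (auto simp: eq_upto_def)

text \<open>Degrees add in a product of monomials, so a coefficient of degree at most
  \<open>N\<close> only sees coefficients of the factors of degree at most \<open>N\<close>.\<close>

lemma eq_upto_mult:
  fixes f g :: "('v, 'a::comm_ring_1) mps"
  assumes "eq_upto N f f'" "eq_upto N g g'"
  shows "eq_upto N (f * g) (f' * g')"
  unfolding eq_upto_def mps_coeff_mult
proof (intro allI impI sum.cong refl, clarify)
  fix a b :: "'v multiset"
  assume "size (a + b) \<le> N"
  then have "size a \<le> N" "size b \<le> N" by auto
  then show "mps_coeff f a * mps_coeff g b = mps_coeff f' a * mps_coeff g' b"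
    using assms by (simp add: eq_upto_def)
qed

lemma eq_upto_sum:
  fixes f g :: "'i \<Rightarrow> ('v, 'a::comm_ring_1) mps"
  assumes "\<And>i. i \<in> A \<Longrightarrow> eq_upto N (f i) (g i)"
  shows "eq_upto N (sum f A) (sum g A)"
  using assms by (induction A rule: infinite_finite_induct) (auto intro!: eq_upto_add)

lemma eq_upto_prod:
  fixes f g :: "'i \<Rightarrow> ('v, 'a::comm_ring_1) mps"
  assumes "\<And>i. i \<in> A \<Longrightarrow> eq_upto N (f i) (g i)"
  shows "eq_upto N (prod f A) (prod g A)"
  using assms by (induction A rule: infinite_finite_induct) (auto intro!: eq_upto_mult)

lemma eq_upto_prod_subset:
  fixes f :: "'i \<Rightarrow> ('v, 'a::comm_ring_1) mps"
  assumes "finite B" "A \<subseteq> B" "\<And>i. i \<in> B - A \<Longrightarrow> eq_upto N (f i) 1"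
  shows "eq_upto N (prod f B) (prod f A)"
proof -
  have "prod f B = prod f (B - A) * prod f A"
    using assms(1,2) by (simp add: prod.subset_diff)
  moreover have "eq_upto N (prod f (B - A)) (\<Prod>i\<in>B - A. 1)"
    by (rule eq_upto_prod) (use assms(3) in auto)
  then have "eq_upto N (prod f (B - A) * prod f A) (1 * prod f A)"
    by (intro eq_upto_mult) auto
  ultimately show ?thesis by simp
qed

lemma eq_upto_sum_subset:
  fixes f :: "'i \<Rightarrow> ('v, 'a::comm_ring_1) mps"
  assumes "finite B" "A \<subseteq> B" "\<And>i. i \<in> B - A \<Longrightarrow> eq_upto N (f i) 0"
  shows "eq_upto N (sum f B) (sum f A)"
proof -
  have "sum f B = sum f (B - A) + sum f A"
    using assms(1,2) by (simp add: sum.subset_diff)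
  moreover have "eq_upto N (sum f (B - A)) (\<Sum>i\<in>B - A. 0)"
    by (rule eq_upto_sum) (use assms(3) in auto)
  then have "eq_upto N (sum f (B - A) + sum f A) (0 + sum f A)"
    by (intro eq_upto_add) auto
  ultimately show ?thesis by simp
qed

section \<open>Order of a series\<close>

definition order_ge :: "nat \<Rightarrow> ('v, 'a::zero) mps \<Rightarrow> bool" where
  "order_ge d f \<longleftrightarrow> (\<forall>m. size m < d \<longrightarrow> mps_coeff f m = 0)"

lemma order_ge_0 [simp]: "order_ge 0 f"
  by (simp add: order_ge_def)

lemma order_ge_mono: "order_ge d f \<Longrightarrow> d' \<le> d \<Longrightarrow> order_ge d' f"
  by (auto simp: order_ge_def)

lemma order_ge_imp_eq_upto:
  fixes f :: "('v, 'a::comm_ring_1) mps"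
  shows "order_ge d f \<Longrightarrow> N < d \<Longrightarrow> eq_upto N f 0"
  by (auto simp: order_ge_def eq_upto_def)

lemma order_ge_mult:
  fixes f g :: "('v, 'a::comm_ring_1) mps"
  assumes "order_ge d f" "order_ge e g"
  shows "order_ge (d + e) (f * g)"
  unfolding order_ge_def mps_coeff_mult
proof (intro allI impI sum.neutral ballI, clarify)
  fix a b :: "'v multiset"
  assume "size (a + b) < d + e"
  then have "size a < d \<or> size b < e" by auto
  then show "mps_coeff f a * mps_coeff g b = 0"
    using assms by (auto simp: order_ge_def)
qed

lemma order_ge_mult_left:
  fixes f g :: "('v, 'a::comm_ring_1) mps"
  shows "order_ge d f \<Longrightarrow> order_ge d (f * g)"
  using order_ge_mult[of d f 0 g] by simp

lemma order_ge_power: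
  fixes f :: "('v, 'a::comm_ring_1) mps"
  assumes "order_ge d f"
  shows "order_ge (n * d) (f ^ n)"
  by (induction n) (auto intro: order_ge_mult[OF assms])

lemma order_ge_var: "order_ge 1 (mps_var v :: ('v, 'a::comm_ring_1) mps)"
  by (auto simp: order_ge_def mps_coeff_var)

lemma order_ge_var_power: "order_ge n (mps_var v ^ n :: ('v, 'a::comm_ring_1) mps)"
  using order_ge_power[OF order_ge_var, of n] by simp


section \<open>Inverses and geometric series\<close>

text \<open>If \<open>u\<close> has no constant term, \<open>u ^ i\<close> contributes nothing below
  degree \<open>i\<close>, so each coefficient can be read off a finite partial sum and no limit has
  to be taken.\<close>

definition mps_geo :: "('v, 'a::comm_ring_1) mps \<Rightarrow> ('v, 'a) mps" where
  "mps_geo u = Abs_mps (\<lambda>m. mps_coeff (\<Sum>i\<le>size m. u ^ i) m)"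

lemma mps_geo_eq_upto:
  assumes "order_ge 1 u"
  shows "eq_upto N (mps_geo u) (\<Sum>i\<le>N. u ^ i)"
  unfolding eq_upto_def
proof (intro allI impI)
  fix m :: "'a multiset"
  assume m: "size m \<le> N"
  have "eq_upto (size m) (\<Sum>i\<le>N. u ^ i) (\<Sum>i\<le>size m. u ^ i)"
  proof (rule eq_upto_sum_subset)
    fix i assume "i \<in> {..N} - {..size m}"
    then show "eq_upto (size m) (u ^ i) 0"
      using order_ge_power[OF assms, of i] by (auto intro: order_ge_imp_eq_upto)
  qed (use m in auto)
  then show "mps_coeff (mps_geo u) m = mps_coeff (\<Sum>i\<le>N. u ^ i) m"
    by (simp add: mps_geo_def eq_upto_def)
qed

text \<open>Telescoping: up to degree \<open>N\<close> the product is \<open>1 - u ^ Suc N\<close>,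
  and the power has order beyond \<open>N\<close>.\<close>

lemma mps_geo_inverse:
  assumes "order_ge 1 u"
  shows "(1 - u) * mps_geo u = 1"
proof (rule eq_upto_imp_eq)
  fix N
  have "eq_upto N ((1 - u) * mps_geo u) ((1 - u) * (\<Sum>i\<le>N. u ^ i))"
    by (intro eq_upto_mult mps_geo_eq_upto assms eq_upto_refl)
  also have "(1 - u) * (\<Sum>i\<le>N. u ^ i) = 1 - u ^ Suc N"
    using one_diff_power_eq[of u "Suc N"] by (simp add: lessThan_Suc_atMost)
  also have "eq_upto N (1 - u ^ Suc N) (1 - 0)"
    using order_ge_power[OF assms, of "Suc N"]
    by (intro eq_upto_diff eq_upto_refl order_ge_imp_eq_upto[of "Suc N"]) auto
  finally show "eq_upto N ((1 - u) * mps_geo u) 1" by simp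
qed

lemma inverse_one_minus:
  assumes "order_ge 1 u"
  shows "inverse (1 - u) = mps_geo u"
  by (rule mps_inverse_unique[OF mps_geo_inverse[OF assms]])

lemma mps_inverse_nonunit:
  fixes f :: "('v, 'a::comm_ring_1) mps"
  shows "(\<nexists>g. f * g = 1) \<Longrightarrow> inverse f = 0"
  unfolding inverse_mps_def by (simp only: if_False)

text \<open>A product is a unit exactly if both factors are; in all other cases both sides take the
  default value 0.\<close>

lemma mps_inverse_mult:
  fixes f g :: "('v, 'a::comm_ring_1) mps"
  shows "inverse (f * g) = inverse f * inverse g"
proof (cases "(\<exists>f'. f * f' = 1) \<and> (\<exists>g'. g * g' = 1)")
  case True
  then obtain f' g' where inv: "f * f' = 1" "g * g' = 1" by blast
  have "(f * g) * (f' * g') = (f * f') * (g * g')" by (simp only: mult_ac)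
  then have "inverse (f * g) = f' * g'"
    using inv by (intro mps_inverse_unique) simp
  then show ?thesis
    using inv by (simp add: mps_inverse_unique)
next
  case False
  then have "inverse f = 0 \<or> inverse g = 0"
    by (auto intro: mps_inverse_nonunit)
  moreover have "\<nexists>h. (f * g) * h = 1"
  proof
    assume "\<exists>h. (f * g) * h = 1"
    then obtain h where "(f * g) * h = 1" ..
    then have "f * (g * h) = 1" "g * (f * h) = 1" by (simp_all add: mult_ac)
    with False show False by blast
  qed
  then have "inverse (f * g) = 0" by (rule mps_inverse_nonunit)
  ultimately show ?thesis by auto
qed

lemma mps_inverse_one [simp]: "inverse 1 = (1 :: ('v, 'a::comm_ring_1) mps)"
  by (rule mps_inverse_unique) simp

lemma mps_inverse_prod:
  fixes f :: "'i \<Rightarrow> ('v, 'a::comm_ring_1) mps"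
  shows "inverse (prod f A) = (\<Prod>i\<in>A. inverse (f i))"
  by (induction A rule: infinite_finite_induct) (simp_all add: mps_inverse_mult)

section \<open>Constant series and division by positive integers\<close>

definition mps_const :: "'a::zero \<Rightarrow> ('v, 'a) mps" where
  "mps_const c = Abs_mps (\<lambda>m. if m = {#} then c else 0)"

lemma mps_coeff_const: "mps_coeff (mps_const c) m = (if m = {#} then c else 0)"
  by (simp add: mps_const_def)

lemma mps_coeff_const_mult:
  fixes f :: "('v, 'a::comm_ring_1) mps"
  shows "mps_coeff (mps_const c * f) m = c * mps_coeff f m"
proof -
  have "mps_coeff (mps_const c * f) m =
      (\<Sum>p\<in>{(a, b). a + b = m}. if p = ({#}, m) then c * mps_coeff f m else 0)"
    unfolding mps_coeff_mult by (auto intro!: sum.cong simp: mps_coeff_const)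
  then show ?thesis
    by (subst (asm) sum.delta) (auto simp: finite_mset_splits)
qed

lemma of_nat_mps: "(of_nat k :: ('v, 'a::comm_ring_1) mps) = mps_const (of_nat k)"
  by (induction k) (auto intro!: mps_eqI simp: mps_coeff_const)

lemma of_nat_mps_inverse:
  fixes k :: nat
  assumes "k > 0"
  shows "of_nat k * inverse (of_nat k :: ('v, rat) mps) = 1"
proof -
  have unit: "of_nat k * mps_const (1 / of_nat k) = (1 :: ('v, rat) mps)"
    by (rule mps_eqI)
      (use assms in \<open>auto simp: of_nat_mps mps_coeff_const_mult mps_coeff_const\<close>)
  then have "inverse (of_nat k :: ('v, rat) mps) = mps_const (1 / of_nat k)"
    by (rule mps_inverse_unique)
  with unit show ?thesis by simp
qed

lemma of_nat_mps_mult_eq_0: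
  fixes f :: "('v, rat) mps"
  assumes "of_nat k * f = 0" "k > 0"
  shows "f = 0"
proof -
  have "f = (of_nat k * inverse (of_nat k)) * f"
    by (simp add: of_nat_mps_inverse[OF assms(2)])
  also have "\<dots> = inverse (of_nat k) * (of_nat k * f)" by (simp only: mult_ac)
  finally show ?thesis by (simp add: assms(1))
qed


section \<open>Convergence\<close>

text \<open>A basic neighbourhood prescribes finitely many coefficients, hence is controlled by the
  degrees up to some bound.\<close>

lemma tendsto_mpsI:
  assumes "\<And>N. eventually (\<lambda>x. eq_upto N (f x) P) F"
  shows "(f \<longlongrightarrow> P) F"
proof (rule topological_tendstoI)
  fix S assume "open S" "P \<in> S"
  then obtain M where M: "finite M" "\<And>g. (\<forall>m\<in>M. mps_coeff g m = mps_coeff P m) \<Longrightarrow> g \<in> S"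
    unfolding open_mps_def by blast
  \<comment> \<open>For empty \<open>M\<close> the bound is vacuous, so the unspecified maximum of
    the empty set does no harm.\<close>
  have "m \<in> M \<Longrightarrow> size m \<le> Max (size ` M)" for m
    using M(1) by auto
  then have "eq_upto (Max (size ` M)) g P \<Longrightarrow> g \<in> S" for g
    by (intro M(2)) (auto simp: eq_upto_def)
  with assms[of "Max (size ` M)"] show "eventually (\<lambda>x. f x \<in> S) F"
    by (auto elim: eventually_mono)
qed

text \<open>Outside the finite set \<open>B N\<close> the terms are invisible up to degree
  \<open>N\<close>. The limit takes its coefficient at \<open>m\<close> from the partial sum over
  \<open>B (size m)\<close>.\<close>

lemma has_sum_mps:
  fixes f :: "'i \<Rightarrow> ('v, 'a::comm_ring_1) mps"
  assumes fin: "\<And>N. finite (B N)" "\<And>N. B N \<subseteq> A"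
    and small: "\<And>N i. i \<in> A - B N \<Longrightarrow> eq_upto N (f i) 0"
  obtains S where "(f has_sum S) A" "\<And>N. eq_upto N S (sum f (B N))"
proof
  let ?S = "Abs_mps (\<lambda>m. mps_coeff (sum f (B (size m))) m)"
  have *: "eq_upto N (sum f C) (sum f (B N))" if "finite C" "B N \<subseteq> C" "C \<subseteq> A" for N C
    using that by (intro eq_upto_sum_subset small) auto
  show **: "eq_upto N ?S (sum f (B N))" for N
    unfolding eq_upto_def
  proof (intro allI impI)
    fix m :: "'v multiset"
    assume "size m \<le> N"
    \<comment> \<open>\<open>B (size m)\<close> and \<open>B N\<close> need not be nested; both
      partial sums are compared with the one over the union.\<close>
    have fin': "finite (B (size m) \<union> B N)" "B (size m) \<union> B N \<subseteq> A" using fin by auto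
    have "eq_upto (size m) (sum f (B (size m) \<union> B N)) (sum f (B (size m)))"
      by (rule *) (use fin' in auto)
    moreover have "eq_upto N (sum f (B (size m) \<union> B N)) (sum f (B N))"
      by (rule *) (use fin' in auto)
    ultimately show "mps_coeff ?S m = mps_coeff (sum f (B N)) m"
      using \<open>size m \<le> N\<close> by (simp add: eq_upto_def)
  qed
  show "(f has_sum ?S) A"
    unfolding has_sum_def
  proof (rule tendsto_mpsI)
    fix N
    show "\<forall>\<^sub>F C in finite_subsets_at_top A. eq_upto N (sum f C) ?S"
      unfolding eventually_finite_subsets_at_top
      by (intro exI[of _ "B N"]) (use fin in \<open>auto intro: eq_upto_trans[OF * eq_upto_sym[OF **]]\<close>)
  qed
qed

text \<open>The construction used for sums, with 1 as the neutral term; uniqueness of limits then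
  identifies the value of \<open>infprod\<close>.\<close>

lemma multipliable_mps:
  fixes f :: "'i \<Rightarrow> ('v, 'a::comm_ring_1) mps"
  assumes fin: "\<And>N. finite (B N)" "\<And>N. B N \<subseteq> A"
    and small: "\<And>N i. i \<in> A - B N \<Longrightarrow> eq_upto N (f i) 1"
  shows "multipliable_on f A" "eq_upto N (infprod f A) (prod f (B N))"
proof -
  let ?P = "Abs_mps (\<lambda>m. mps_coeff (prod f (B (size m))) m)"
  have *: "eq_upto N (prod f C) (prod f (B N))" if "finite C" "B N \<subseteq> C" "C \<subseteq> A" for N C
    using that by (intro eq_upto_prod_subset small) auto
  have **: "eq_upto N ?P (prod f (B N))" for N
    unfolding eq_upto_def
  proof (intro allI impI)
    fix m :: "'v multiset"
    assume "size m \<le> N"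
    have fin': "finite (B (size m) \<union> B N)" "B (size m) \<union> B N \<subseteq> A" using fin by auto
    have "eq_upto (size m) (prod f (B (size m) \<union> B N)) (prod f (B (size m)))"
      by (rule *) (use fin' in auto)
    moreover have "eq_upto N (prod f (B (size m) \<union> B N)) (prod f (B N))"
      by (rule *) (use fin' in auto)
    ultimately show "mps_coeff ?P m = mps_coeff (prod f (B N)) m"
      using \<open>size m \<le> N\<close> by (simp add: eq_upto_def)
  qed
  have lim: "(prod f \<longlongrightarrow> ?P) (finite_subsets_at_top A)"
  proof (rule tendsto_mpsI)
    fix N
    show "\<forall>\<^sub>F C in finite_subsets_at_top A. eq_upto N (prod f C) ?P"
      unfolding eventually_finite_subsets_at_top
      by (intro exI[of _ "B N"]) (use fin in \<open>auto intro: eq_upto_trans[OF * eq_upto_sym[OF **]]\<close>)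
  qed
  then show mult: "multipliable_on f A"
    unfolding multipliable_on_def has_infprod_def by blast
  have "infprod f A = ?P"
    unfolding infprod_def using mult lim by (simp add: tendsto_Lim)
  with ** show "eq_upto N (infprod f A) (prod f (B N))" by simp
qed


section \<open>The Euler derivation\<close>

text \<open>The operator \<open>v d/dv\<close>. Unlike the plain derivative it multiplies each
  monomial by a scalar, so it does not shift degrees.\<close>

definition euler_deriv :: "'v \<Rightarrow> ('v, 'a::comm_ring_1) mps \<Rightarrow> ('v, 'a) mps" where
  "euler_deriv v f = Abs_mps (\<lambda>m. of_nat (count m v) * mps_coeff f m)"

lemma mps_coeff_euler_deriv [simp]:
  "mps_coeff (euler_deriv v f) m = of_nat (count m v) * mps_coeff f m"
  by (simp add: euler_deriv_def)

lemma euler_deriv_linear [simp]: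
  "euler_deriv v 0 = 0" "euler_deriv v 1 = 0"
  "euler_deriv v (f + g) = euler_deriv v f + euler_deriv v g"
  "euler_deriv v (f - g) = euler_deriv v f - euler_deriv v g"
  "euler_deriv v (- f) = - euler_deriv v f"
  by (auto intro!: mps_eqI simp: algebra_simps)

text \<open>The exponent of \<open>v\<close> is additive over every splitting
  \<open>a + b = m\<close>.\<close>

lemma euler_deriv_mult:
  "euler_deriv v (f * g) = euler_deriv v f * g + f * euler_deriv v g"
proof (rule mps_eqI)
  fix m
  have "mps_coeff (euler_deriv v (f * g)) m =
      (\<Sum>(a, b) | a + b = m. of_nat (count a v) * mps_coeff f a * mps_coeff g b +
        mps_coeff f a * (of_nat (count b v) * mps_coeff g b))"
    by (auto simp: mps_coeff_mult sum_distrib_left algebra_simps intro!: sum.cong)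
  then show "mps_coeff (euler_deriv v (f * g)) m =
      mps_coeff (euler_deriv v f * g + f * euler_deriv v g) m"
    by (simp add: mps_coeff_mult sum.distrib case_prod_beta)
qed

lemma euler_deriv_sum: "euler_deriv v (sum f A) = (\<Sum>i\<in>A. euler_deriv v (f i))"
  by (induction A rule: infinite_finite_induct) simp_all

lemma euler_deriv_var:
  "euler_deriv v (mps_var w) = (if v = w then mps_var w else 0)"
  by (auto intro!: mps_eqI simp: mps_coeff_var)

lemma euler_deriv_prod_eq_0:
  "(\<And>i. i \<in> A \<Longrightarrow> euler_deriv v (f i) = 0) \<Longrightarrow> euler_deriv v (prod f A) = 0"
  by (induction A rule: infinite_finite_induct) (simp_all add: euler_deriv_mult)

lemma euler_deriv_power_eq_0: "euler_deriv v f = 0 \<Longrightarrow> euler_deriv v (f ^ n) = 0"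
  by (induction n) (simp_all add: euler_deriv_mult)

lemma euler_deriv_of_nat [simp]: "euler_deriv v (of_nat n) = 0"
  by (induction n) simp_all

text \<open>Differentiate \<open>f * g = 1\<close> and multiply by \<open>g\<close>; for a nonunit
  the inverse is 0 by default.\<close>

lemma euler_deriv_inverse_eq_0:
  assumes "euler_deriv v f = 0"
  shows "euler_deriv v (inverse f) = 0"
proof (cases "\<exists>g. f * g = 1")
  case True
  then obtain g where g: "f * g = 1" by blast
  have "f * euler_deriv v g = 0"
    using arg_cong[OF g, of "euler_deriv v"] by (simp add: euler_deriv_mult assms)
  moreover have "euler_deriv v g = g * (f * euler_deriv v g)"
    using g by (metis mult.assoc mult.commute mult.left_neutral)
  ultimately have "euler_deriv v g = 0" by simp
  with g show ?thesis by (simp add: mps_inverse_unique)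
next
  case False
  then have "inverse f = 0" by (rule mps_inverse_nonunit)
  then show ?thesis by simp
qed

lemma euler_deriv_var_power: "euler_deriv v (mps_var v ^ n) = of_nat n * mps_var v ^ n"
  by (induction n) (simp_all add: euler_deriv_mult euler_deriv_var algebra_simps)

lemma euler_deriv_mult_var_power:
  assumes "euler_deriv v f = 0"
  shows "euler_deriv v (f * mps_var v ^ n) = of_nat n * (f * mps_var v ^ n)"
  by (simp add: euler_deriv_mult euler_deriv_var_power assms algebra_simps)

text \<open>Here \<open>u i\<close> acts as the logarithmic derivative of \<open>f i\<close>, and
  logarithmic derivatives of a product add up.\<close>

lemma euler_deriv_prod_log:
  assumes "\<And>i. i \<in> A \<Longrightarrow> euler_deriv v (f i) = f i * u i" "finite A"
  shows "euler_deriv v (prod f A) = prod f A * sum u A"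
  using assms(2,1)
  by (induction A rule: finite_induct) (simp_all add: euler_deriv_mult algebra_simps)

lemma mps_coeff_var_mult:
  fixes f :: "('v, 'a::comm_ring_1) mps"
  assumes "v \<notin># m"
  shows "mps_coeff (mps_var v * f) m = 0"
  unfolding mps_coeff_mult
  by (rule sum.neutral) (use assms in \<open>auto simp: mps_coeff_var\<close>)

text \<open>A linear equation \<open>y E' = E P\<close> with \<open>P\<close> divisible by \<open>y\<close> determines \<open>E\<close> from its value at
  \<open>y = 0\<close>: the coefficients of a difference of solutions vanish by induction on the degree.\<close>

lemma euler_deriv_unique:
  fixes E F P :: "('v, rat) mps"
  assumes E: "eq_upto N (euler_deriv v E) (E * (mps_var v * P))"
    and F: "eq_upto N (euler_deriv v F) (F * (mps_var v * P))"
    and init: "\<And>m. v \<notin># m \<Longrightarrow> mps_coeff E m = mps_coeff F m"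
  shows "eq_upto N E F"
proof -
  define D where "D = E - F"
  have D: "eq_upto N (euler_deriv v D) (D * (mps_var v * P))"
    using eq_upto_diff[OF E F] by (simp add: D_def algebra_simps)
  have "mps_coeff D m = 0" if "size m \<le> N" for m
    using that
  proof (induction "size m" arbitrary: m rule: less_induct)
    case less
    show ?case
    proof (cases "v \<in># m")
      case True
      have "of_nat (count m v) * mps_coeff D m = mps_coeff (D * (mps_var v * P)) m"
        using D less.prems by (simp add: eq_upto_def)
      also have "\<dots> = 0"
        unfolding mps_coeff_mult[of D]
      proof (intro sum.neutral ballI, clarify)
        fix a b assume m: "m = a + b"
        show "mps_coeff D a * mps_coeff (mps_var v * P) b = 0"
        \<comment> \<open>Only monomials \<open>b\<close> containing \<open>v\<close> occur in the
          second factor; then \<open>a\<close> has smaller degree and the induction hypothesis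
          applies.\<close>
        proof (cases "v \<in># b")
          case True
          then have "size a < size m" using m by (cases b) auto
          with less show ?thesis by simp
        qed (simp add: mps_coeff_var_mult)
      qed
      \<comment> \<open>The exponent of \<open>v\<close> in \<open>m\<close> is a nonzero rational
        and can be cancelled.\<close>
      finally show ?thesis using True by (simp flip: count_greater_zero_iff)
    qed (use init in \<open>simp add: D_def\<close>)
  qed
  then show ?thesis by (simp add: eq_upto_def D_def)
qed


section \<open>Weighted permutation matrices\<close>

text \<open>Constant weight 1 gives the determinant of the theorem; arbitrary weights make the
  family closed under removal of a letter. The weight is attached to the row, that is, to the target
  of the arrow from \<open>j\<close> to \<open>\<sigma> j\<close>.\<close>

definition weighted_det ::
    "nat \<Rightarrow> (nat \<Rightarrow> nat) \<Rightarrow> (nat \<Rightarrow> nat) \<Rightarrow> 'a::comm_ring_1 \<Rightarrow> 'a" where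
  "weighted_det n \<sigma> e x = det (mat n n (\<lambda>(i, j).
     (if i = j then 1 else 0) - (if i = \<sigma> j then x ^ e i else 0)))"

lemma det_one_minus_perm_matrix:
  "det (1\<^sub>m n - x \<cdot>\<^sub>m perm_matrix n \<sigma>) = weighted_det n \<sigma> (\<lambda>_. 1) x"
  unfolding weighted_det_def perm_matrix_def by (rule arg_cong[where f = det]) (auto intro!: eq_matI)

lemma weighted_det_0 [simp]: "weighted_det 0 \<sigma> e x = 1"
  unfolding weighted_det_def by (rule det_dim_zero) simp

lemma det_last_column_unit:
  fixes A :: "'a::comm_ring_1 mat"
  assumes A: "A \<in> carrier_mat (Suc n) (Suc n)"
    and col: "\<And>i. i < n \<Longrightarrow> A $$ (i, n) = 0"
  shows "det A = A $$ (n, n) * det (mat n n (\<lambda>(i, j). A $$ (i, j)))"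
proof -
  have "det A = (\<Sum>i<Suc n. A $$ (i, n) * cofactor A i n)"
    by (rule laplace_expansion_column[OF A]) simp
  also have "\<dots> = A $$ (n, n) * cofactor A n n"
    by (simp add: col)
  also have "mat_delete A n n = mat n n (\<lambda>(i, j). A $$ (i, j))"
    using A by (auto simp: mat_delete_def intro!: eq_matI)
  then have "cofactor A n n = det (mat n n (\<lambda>(i, j). A $$ (i, j)))"
    unfolding cofactor_def by (simp add: power_add flip: power_mult_distrib)
  finally show ?thesis .
qed

text \<open>A fixed letter \<open>n\<close> leaves \<open>1 - x ^ e n\<close> as the only entry of
  its column, so expansion along that column suffices.\<close>

lemma weighted_det_fixed:
  assumes "q permutes {0..<n}"
  shows "weighted_det (Suc n) q e x = (1 - x ^ e n) * weighted_det n q e x"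
proof -
  have q: "q n = n" "\<And>i. i < n \<Longrightarrow> i \<noteq> n"
    using permutes_not_in[OF assms] by auto
  show ?thesis
    unfolding weighted_det_def
    by (subst det_last_column_unit[where n = n])
      (auto simp: q intro!: arg_cong2[where f = "(*)"] arg_cong[where f = det] eq_matI)
qed

text \<open>Eliminating the last index from a cycle of length at least two is a Schur complement: it
  joins two consecutive edges of the cycle into one, and their weights add up.\<close>

lemma weighted_det_skip:
  fixes x :: "'a::comm_ring_1"
  assumes q: "q permutes {0..<n}" and b: "b < n"
  shows "weighted_det (Suc n) (transpose n b \<circ> q) e x = weighted_det n q (e(b := e b + e n)) x"
proof -
  let ?\<sigma> = "transpose n b \<circ> q"
  define A :: "'a mat" where "A = mat (Suc n) (Suc n) (\<lambda>(i, j).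
     (if i = j then 1 else 0) - (if i = ?\<sigma> j then x ^ e i else 0))"
  have qn: "q n = n" using permutes_not_in[OF q] by auto
  have q_less: "q j < n" if "j < n" for j
    using permutes_in_image[OF q, of j] that by simp
  have \<sigma>n: "?\<sigma> n = b" by (simp add: qn)
  have \<sigma>: "?\<sigma> j = (if q j = b then n else q j)" if "j < n" for j
    using q_less[OF that] by (simp add: transpose_def)
  \<comment> \<open>Column \<open>n\<close> of \<open>A\<close> has 1 in row \<open>n\<close> and
    \<open>- x ^ e b\<close> in row \<open>b\<close>. This row operation clears the latter and moves
    the entry \<open>- x ^ e n\<close>, in the column that \<open>q\<close> sends to
    \<open>b\<close>, to row \<open>b\<close> with exponent \<open>e b + e n\<close>.\<close>
  define B where "B = addrow (x ^ e b) b n A"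
  have A: "A \<in> carrier_mat (Suc n) (Suc n)" by (simp add: A_def)
  have "weighted_det (Suc n) ?\<sigma> e x = det A"
    by (simp only: weighted_det_def A_def)
  also have "\<dots> = det B"
    unfolding B_def by (rule det_addrow[symmetric, OF _ _ A]) (use b in auto)
  also have "\<dots> = B $$ (n, n) * det (mat n n (\<lambda>(i, j). B $$ (i, j)))"
  proof (rule det_last_column_unit)
    fix i assume "i < n"
    then show "B $$ (i, n) = 0"
      using b by (cases "i = b") (simp_all add: B_def A_def \<sigma>n del: o_apply)
  qed (simp add: B_def A_def)
  also have "B $$ (n, n) = 1"
    using b by (simp add: B_def A_def \<sigma>n del: o_apply)
  also have "mat n n (\<lambda>(i, j). B $$ (i, j)) = mat n n (\<lambda>(i, j). (if i = j then 1 else 0) -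
      (if i = q j then x ^ (e(b := e b + e n)) i else 0))"
  proof (rule eq_matI)
    fix i j
    assume "i < dim_row (mat n n (\<lambda>(i, j). (if i = j then 1 else 0) -
        (if i = q j then x ^ (e(b := e b + e n)) i else (0::'a))))"
      and "j < dim_col (mat n n (\<lambda>(i, j). (if i = j then 1 else 0) -
        (if i = q j then x ^ (e(b := e b + e n)) i else (0::'a))))"
    then have ij: "i < n" "j < n" by simp_all
    then show "mat n n (\<lambda>(i, j). B $$ (i, j)) $$ (i, j) =
        mat n n (\<lambda>(i, j). (if i = j then 1 else 0) -
          (if i = q j then x ^ (e(b := e b + e n)) i else 0)) $$ (i, j)"
      using b \<sigma>[OF ij(2)] q_less[OF ij(2)] by (auto simp: B_def A_def power_add simp del: o_apply)
  qed auto
  finally show ?thesis by (simp add: weighted_det_def)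
qed

text \<open>Relabelling the letters together with their weights permutes rows and columns
  simultaneously, and the two signs cancel.\<close>

lemma weighted_det_conj:
  fixes x :: "'a::comm_ring_1"
  assumes a: "a < n" and b: "b < n" and s: "\<sigma> permutes {0..<n}"
  shows "weighted_det n (transpose a b \<circ> \<sigma> \<circ> transpose a b) (e \<circ> transpose a b) x =
    weighted_det n \<sigma> e x"
proof -
  let ?t = "transpose a b"
  have t: "?t permutes {0..<n}" using a b by (intro permutes_swap_id) auto
  have t_less: "?t i < n" if "i < n" for i
    using permutes_in_image[OF t, of i] that by simp
  define A :: "'a mat" where "A = mat n n (\<lambda>(i, j).
     (if i = j then 1 else 0) - (if i = \<sigma> j then x ^ e i else 0))"
  have A: "A \<in> carrier_mat n n" by (simp add: A_def)
  define B where "B = mat n n (\<lambda>(i, j). A $$ (?t i, j))"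
  have B: "B \<in> carrier_mat n n" by (simp add: B_def)
  have flip: "i = ?t y \<longleftrightarrow> ?t i = y" for i y
    by (metis transpose_involutory)
  \<comment> \<open>The column permutation is written as a row permutation of the transpose, so one
    rule for rows serves twice.\<close>
  have "mat n n (\<lambda>(i, j). (if i = j then 1 else 0) -
        (if i = (?t \<circ> \<sigma> \<circ> ?t) j then x ^ (e \<circ> ?t) i else 0)) =
      transpose_mat (mat n n (\<lambda>(i, j). transpose_mat B $$ (?t i, j)))"
    by (rule eq_matI) (auto simp: B_def A_def t_less flip)
  then have "weighted_det n (?t \<circ> \<sigma> \<circ> ?t) (e \<circ> ?t) x =
      det (mat n n (\<lambda>(i, j). transpose_mat B $$ (?t i, j)))"
    unfolding weighted_det_def by (simp add: det_transpose[of _ n])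
  also have "\<dots> = signof ?t * det B"
    using B by (subst det_permute_rows[OF _ t]) (auto simp: det_transpose[OF B])
  also have "det B = signof ?t * det A"
    unfolding B_def by (rule det_permute_rows[OF A t])
  also have "signof ?t * (signof ?t * det A) = det A"
    by (simp add: sign_def)
  finally show ?thesis by (simp only: A_def weighted_det_def)
qed


section \<open>Newton's recursion for sums over permutations\<close>

text \<open>\<open>V n k\<close> below is the sum over \<open>S\<^sub>n\<^sub>+\<^sub>1\<close> in which the last letter has weight \<open>k\<close>.
  Removing that letter either removes a fixed point or transfers its weight to another letter.\<close>

lemma permutation_sum_recursion:
  fixes \<Phi> :: "nat \<Rightarrow> (nat \<Rightarrow> nat) \<Rightarrow> (nat \<Rightarrow> nat) \<Rightarrow> 'a::comm_ring_1"
    and p c :: "nat \<Rightarrow> 'a"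
  assumes fixed: "\<And>n q e. q permutes {0..<n} \<Longrightarrow> \<Phi> (Suc n) q e = p (e n) * \<Phi> n q e"
    and skip: "\<And>n q b e. q permutes {0..<n} \<Longrightarrow> b < n \<Longrightarrow>
      \<Phi> (Suc n) (transpose n b \<circ> q) e = \<Phi> n q (e(b := e b + e n))"
    and conj: "\<And>n q a b e. q permutes {0..<n} \<Longrightarrow> a < n \<Longrightarrow> b < n \<Longrightarrow>
      \<Phi> n (transpose a b \<circ> q \<circ> transpose a b) (e \<circ> transpose a b) = \<Phi> n q e"
    and local: "\<And>n q e e'. (\<And>i. i < n \<Longrightarrow> e i = e' i) \<Longrightarrow> \<Phi> n q e = \<Phi> n q e'"
    and c: "c 0 = 1" "\<And>n. of_nat (Suc n) * c (Suc n) = c n"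
  defines "W \<equiv> \<lambda>n. \<Sum>\<sigma> | \<sigma> permutes {0..<n}. \<Phi> n \<sigma> (\<lambda>_. 1)"
  shows "of_nat (Suc n) * (c (Suc n) * W (Suc n)) = (\<Sum>i\<le>n. p (Suc i) * (c (n - i) * W (n - i)))"
proof -
  define V where "V n k = (\<Sum>\<sigma> | \<sigma> permutes {0..<Suc n}. \<Phi> (Suc n) \<sigma> ((\<lambda>_. 1)(n := k)))" for n k
  \<comment> \<open>The position of the exceptional weight is irrelevant: conjugation by a
    transposition moves it to the last letter and permutes the summation range.\<close>
  have move: "(\<Sum>q | q permutes {0..<Suc n}. \<Phi> (Suc n) q ((\<lambda>_. 1)(b := k))) = V n k"
    if b: "b < Suc n" for n b k
  proof -
    let ?t = "transpose n b"
    have t: "?t permutes {0..<Suc n}" using b by (intro permutes_swap_id) auto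
    have e: "((\<lambda>_. 1)(b := k)) \<circ> ?t = ((\<lambda>_. 1)(n := k))"
      by (auto simp: fun_eq_iff transpose_def)
    show ?thesis
      unfolding V_def
    proof (rule sum.reindex_bij_witness[where i = "\<lambda>q. ?t \<circ> q \<circ> ?t" and j = "\<lambda>q. ?t \<circ> q \<circ> ?t"])
      fix q assume "q \<in> {q. q permutes {0..<Suc n}}"
      then have q: "q permutes {0..<Suc n}" by simp
      show "?t \<circ> (?t \<circ> q \<circ> ?t) \<circ> ?t = q" by (simp add: fun_eq_iff)
      show "?t \<circ> q \<circ> ?t \<in> {q. q permutes {0..<Suc n}}"
        using permutes_compose[OF permutes_compose[OF t q] t] by (simp add: comp_assoc)
      show "\<Phi> (Suc n) (?t \<circ> q \<circ> ?t) ((\<lambda>_. 1)(n := k)) = \<Phi> (Suc n) q ((\<lambda>_. 1)(b := k))"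
        using conj[OF q lessI b, of "(\<lambda>_. 1)(b := k)"] by (simp only: e)
    qed (use t in \<open>auto intro!: permutes_compose simp: fun_eq_iff\<close>)
  qed
  \<comment> \<open>Each permutation of \<open>n + 1\<close> letters is uniquely
    \<open>transpose n b \<circ> q\<close> with \<open>q\<close> fixing \<open>n\<close>: for
    \<open>b = n\<close> the letter is a fixed point, otherwise \<open>b\<close> inherits its
    weight. For \<open>n = 0\<close> the sum over \<open>b\<close> is empty, so the truncated
    \<open>n - 1\<close> is harmless.\<close>
  have V_rec: "V n k = p k * W n + (\<Sum>b<n. V (n - 1) (Suc k))" for n k
  proof -
    have "V n k = (\<Sum>b\<in>insert n {0..<n}. \<Sum>q | q permutes {0..<n}.
        \<Phi> (Suc n) (transpose n b \<circ> q) ((\<lambda>_. 1)(n := k)))"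
      unfolding V_def atLeast0_lessThan_Suc by (rule sum_over_permutations_insert) auto
    also have "\<dots> = (\<Sum>q | q permutes {0..<n}. \<Phi> (Suc n) q ((\<lambda>_. 1)(n := k))) +
        (\<Sum>b<n. \<Sum>q | q permutes {0..<n}. \<Phi> (Suc n) (transpose n b \<circ> q) ((\<lambda>_. 1)(n := k)))"
      by (simp add: lessThan_atLeast0)
    also have "(\<Sum>q | q permutes {0..<n}. \<Phi> (Suc n) q ((\<lambda>_. 1)(n := k))) = p k * W n"
      unfolding W_def sum_distrib_left
    proof (rule sum.cong[OF refl])
      fix q assume "q \<in> {q. q permutes {0..<n}}"
      then have "\<Phi> (Suc n) q ((\<lambda>_. 1)(n := k)) = p k * \<Phi> n q ((\<lambda>_. 1)(n := k))"
        using fixed[of q n "(\<lambda>_. 1)(n := k)"] by simp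
      also have "\<Phi> n q ((\<lambda>_. 1)(n := k)) = \<Phi> n q (\<lambda>_. 1)" by (rule local) simp
      finally show "\<Phi> (Suc n) q ((\<lambda>_. 1)(n := k)) = p k * \<Phi> n q (\<lambda>_. 1)" .
    qed
    also have "(\<Sum>b<n. \<Sum>q | q permutes {0..<n}. \<Phi> (Suc n) (transpose n b \<circ> q) ((\<lambda>_. 1)(n := k))) =
        (\<Sum>b<n. V (n - 1) (Suc k))"
    proof (rule sum.cong[OF refl])
      fix b assume "b \<in> {..<n}"
      then have b: "b < n" "Suc (n - 1) = n" by auto
      have "(\<Sum>q | q permutes {0..<n}. \<Phi> (Suc n) (transpose n b \<circ> q) ((\<lambda>_. 1)(n := k))) =
          (\<Sum>q | q permutes {0..<n}. \<Phi> n q ((\<lambda>_. 1)(b := Suc k)))"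
      proof (rule sum.cong[OF refl])
        \<comment> \<open>After \<open>skip\<close>, letter \<open>b\<close> weighs
          \<open>1 + k\<close>. The two weight functions still differ at \<open>n\<close>, which
          \<open>local\<close> ignores.\<close>
        fix q assume "q \<in> {q. q permutes {0..<n}}"
        then show "\<Phi> (Suc n) (transpose n b \<circ> q) ((\<lambda>_. 1)(n := k)) = \<Phi> n q ((\<lambda>_. 1)(b := Suc k))"
          using skip[of q n b "(\<lambda>_. 1)(n := k)"] b by (auto intro: local)
      qed
      also have "\<dots> = V (n - 1) (Suc k)"
        using move[of b "n - 1" "Suc k"] b by simp
      finally show "(\<Sum>q | q permutes {0..<n}. \<Phi> (Suc n) (transpose n b \<circ> q) ((\<lambda>_. 1)(n := k))) =
          V (n - 1) (Suc k)" .
    qed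
    finally show ?thesis .
  qed
  \<comment> \<open>Unrolling \<open>V_rec\<close>: the equal summands are as many as the factor
    that turns \<open>c (Suc n)\<close> into \<open>c n\<close>, and the weight rises by one at each
    step.\<close>
  have V_sum: "c n * V n k = (\<Sum>i\<le>n. p (k + i) * (c (n - i) * W (n - i)))" for n k
  proof (induction n arbitrary: k)
    case 0
    have "V 0 k = p k * W 0" by (subst V_rec) simp
    then show ?case by (simp add: mult_ac)
  next
    case (Suc n)
    have "c (Suc n) * V (Suc n) k =
        p k * (c (Suc n) * W (Suc n)) + (of_nat (Suc n) * c (Suc n)) * V n (Suc k)"
      by (subst V_rec) (simp add: algebra_simps)
    also have "\<dots> = p k * (c (Suc n) * W (Suc n)) + c n * V n (Suc k)"
      by (simp only: c(2))
    finally show ?case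
      by (subst sum.atMost_Suc_shift) (simp add: Suc.IH)
  qed
  have WV: "W (Suc n) = V n 1"
    by (simp add: W_def V_def fun_upd_def)
  have "of_nat (Suc n) * (c (Suc n) * W (Suc n)) = (of_nat (Suc n) * c (Suc n)) * W (Suc n)"
    by (simp only: mult_ac)
  also have "\<dots> = c n * V n 1"
    by (simp only: c(2) WV)
  also have "\<dots> = (\<Sum>i\<le>n. p (Suc i) * (c (n - i) * W (n - i)))"
    by (simp only: V_sum plus_1_eq_Suc)
  finally show ?thesis .
qed


section \<open>Series over the integers\<close>

lemma mps_coeff_of_int [simp]: "mps_coeff (mps_of_int f) m = of_int (mps_coeff f m)"
  by (simp add: mps_of_int_def)

lemma mps_of_int_eq_upto: "eq_upto N f g \<Longrightarrow> eq_upto N (mps_of_int f) (mps_of_int g)"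
  by (simp add: eq_upto_def)

lemma mps_of_int_hom [simp]:
  "mps_of_int 1 = (1 :: ('v, 'a::comm_ring_1) mps)"
  "mps_of_int (f - g) = (mps_of_int f - mps_of_int g :: ('v, 'a) mps)"
  "mps_of_int (mps_var v) = (mps_var v :: ('v, 'a) mps)"
  by (auto intro!: mps_eqI simp: mps_coeff_var)

lemma mps_of_int_mult [simp]:
  "mps_of_int (f * g) = (mps_of_int f * mps_of_int g :: ('v, 'a::comm_ring_1) mps)"
  by (rule mps_eqI) (simp add: mps_coeff_mult case_prod_beta)

lemma mps_of_int_power [simp]:
  "mps_of_int (f ^ n) = (mps_of_int f ^ n :: ('v, 'a::comm_ring_1) mps)"
  by (induction n) simp_all

lemma mps_of_int_prod [simp]:
  "mps_of_int (prod f A) = (\<Prod>i\<in>A. mps_of_int (f i) :: ('v, 'a::comm_ring_1) mps)"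
  by (induction A rule: infinite_finite_induct) simp_all

text \<open>Stated for integral units: the integral inverse of 2 defaults to 0, whereas 2 may be
  invertible in the target ring.\<close>

lemma mps_of_int_inverse:
  assumes "f * g = 1"
  shows "mps_of_int (inverse f) = (inverse (mps_of_int f) :: ('v, 'a::comm_ring_1) mps)"
proof -
  have "mps_of_int f * mps_of_int g = (1 :: ('v, 'a) mps)"
    by (simp only: assms flip: mps_of_int_mult) simp
  then show ?thesis by (simp add: mps_inverse_unique[OF assms] mps_inverse_unique)
qed

section \<open>Series in a prescribed set of variables\<close>

lemma mps_over_one: "(1 :: ('v, 'a::comm_ring_1) mps) \<in> mps_over V"
  by (simp add: mps_over_def)

lemma mps_over_diff:
  fixes f g :: "('v, 'a::comm_ring_1) mps"
  assumes "f \<in> mps_over V" "g \<in> mps_over V"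
  shows "f - g \<in> mps_over V"
  unfolding mps_over_def
proof (intro CollectI allI impI)
  fix m assume "mps_coeff (f - g) m \<noteq> 0"
  then have "mps_coeff f m \<noteq> 0 \<or> mps_coeff g m \<noteq> 0" by auto
  with assms show "set_mset m \<subseteq> V" by (auto simp: mps_over_def)
qed

lemma mps_over_add:
  fixes f g :: "('v, 'a::comm_ring_1) mps"
  assumes "f \<in> mps_over V" "g \<in> mps_over V"
  shows "f + g \<in> mps_over V"
  unfolding mps_over_def
proof (intro CollectI allI impI)
  fix m assume "mps_coeff (f + g) m \<noteq> 0"
  then have "mps_coeff f m \<noteq> 0 \<or> mps_coeff g m \<noteq> 0" by auto
  with assms show "set_mset m \<subseteq> V" by (auto simp: mps_over_def)
qed

lemma mps_over_mult:
  fixes f g :: "('v, 'a::comm_ring_1) mps"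
  assumes "f \<in> mps_over V" "g \<in> mps_over V"
  shows "f * g \<in> mps_over V"
  unfolding mps_over_def
proof (intro CollectI allI impI)
  fix m assume "mps_coeff (f * g) m \<noteq> 0"
  then obtain a b where "a + b = m" "mps_coeff f a * mps_coeff g b \<noteq> 0"
    unfolding mps_coeff_mult by (auto elim: sum.not_neutral_contains_not_neutral)
  moreover from this have "mps_coeff f a \<noteq> 0" "mps_coeff g b \<noteq> 0" by auto
  with assms have "set_mset a \<subseteq> V" "set_mset b \<subseteq> V"
    unfolding mps_over_def by blast+
  ultimately show "set_mset m \<subseteq> V" by auto
qed

lemma mps_over_power: "f \<in> mps_over V \<Longrightarrow> f ^ n \<in> mps_over V"
  for f :: "('v, 'a::comm_ring_1) mps"
  by (induction n) (auto intro: mps_over_mult mps_over_one)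

lemma mps_over_prod:
  fixes f :: "'i \<Rightarrow> ('v, 'a::comm_ring_1) mps"
  shows "(\<And>i. i \<in> A \<Longrightarrow> f i \<in> mps_over V) \<Longrightarrow> prod f A \<in> mps_over V"
  by (induction A rule: infinite_finite_induct) (auto intro: mps_over_mult mps_over_one)

lemma mps_over_var: "v \<in> V \<Longrightarrow> (mps_var v :: ('v, 'a::comm_ring_1) mps) \<in> mps_over V"
  by (simp add: mps_over_def mps_coeff_var)

lemma mps_over_limit:
  assumes "\<And>N. eq_upto N f (g N)" "\<And>N. g N \<in> mps_over V"
  shows "f \<in> mps_over V"
  unfolding mps_over_def
proof (intro CollectI allI impI)
  fix m assume "mps_coeff f m \<noteq> 0"
  then have "mps_coeff (g (size m)) m \<noteq> 0"
    using assms(1)[of "size m"] by (simp add: eq_upto_def)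
  with assms(2)[of "size m"] show "set_mset m \<subseteq> V" by (simp add: mps_over_def)
qed

lemma mps_over_geo:
  fixes u :: "('v, 'a::comm_ring_1) mps"
  assumes "order_ge 1 u" "u \<in> mps_over V"
  shows "mps_geo u \<in> mps_over V"
proof (rule mps_over_limit)
  show "eq_upto N (mps_geo u) (\<Sum>i\<le>N. u ^ i)" for N
    by (rule mps_geo_eq_upto[OF assms(1)])
  show "(\<Sum>i\<le>N. u ^ i) \<in> mps_over V" for N
    by (induction N) (auto intro: mps_over_one mps_over_add mps_over_mult mps_over_power assms(2))
qed


section \<open>The factors of the product\<close>

definition xq_monomial ::
    "nat \<Rightarrow> nat \<Rightarrow> (nat \<Rightarrow> nat) \<Rightarrow> (nat \<Rightarrow> nat) \<Rightarrow> (var, 'a::comm_ring_1) mps" where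
  "xq_monomial r s j k = (\<Prod>i = 1..r. X i ^ j i) * (\<Prod>i = 1..s. Q i ^ k i)"

text \<open>For even \<open>|j|\<close> the exponent is -1, and the inverse is given directly as a
  geometric series.\<close>

definition xqy_factor ::
    "nat \<Rightarrow> nat \<Rightarrow> (nat \<Rightarrow> nat) \<Rightarrow> (nat \<Rightarrow> nat) \<Rightarrow> (var, 'a::comm_ring_1) mps" where
  "xqy_factor r s j k = (if even (\<Sum>i = 1..r. j i) then mps_geo (Y * xq_monomial r s j k)
     else 1 - Y * xq_monomial r s j k)"

lemma order_ge_Y_mult: "order_ge 1 (Y * f :: (var, 'a::comm_ring_1) mps)"
  by (rule order_ge_mult_left[OF order_ge_var])

lemma mps_geo_unfold:
  assumes "order_ge 1 u"
  shows "mps_geo u = 1 + u * mps_geo u"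
  using mps_geo_inverse[OF assms] by (simp add: algebra_simps)

lemma xqy_factor_powi:
  "(1 - Y * (\<Prod>i = 1..r. X i ^ j i) * (\<Prod>i = 1..s. Q i ^ k i))
     powi ((-1) ^ ((\<Sum>i = 1..r. j i) + 1)) = (xqy_factor r s j k :: (var, 'a::comm_ring_1) mps)"
proof (cases "even (\<Sum>i = 1..r. j i)")
  case True
  then have "(-1 :: int) ^ ((\<Sum>i = 1..r. j i) + 1) = -1" by simp
  then show ?thesis
    using True inverse_one_minus[OF order_ge_Y_mult, of "xq_monomial r s j k :: (var, 'a) mps"]
    by (simp only: xqy_factor_def xq_monomial_def power_int_def mult.assoc) simp
next
  case False
  then have "(-1 :: int) ^ ((\<Sum>i = 1..r. j i) + 1) = 1" by simp
  then show ?thesis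
    using False
    by (simp only: xqy_factor_def xq_monomial_def power_int_def mult.assoc) simp
qed

lemma xqy_factor_of_int:
  "mps_of_int (xqy_factor r s j k) = (xqy_factor r s j k :: (var, 'a::comm_ring_1) mps)"
proof -
  let ?u = "Y * xq_monomial r s j k :: (var, int) mps"
  have u: "mps_of_int ?u = (Y * xq_monomial r s j k :: (var, 'a) mps)"
    by (simp add: xq_monomial_def)
  have "mps_of_int (mps_geo ?u) = (inverse (1 - mps_of_int ?u) :: (var, 'a) mps)"
    using mps_of_int_inverse[OF mps_geo_inverse[OF order_ge_Y_mult], where 'a = 'a]
    by (simp only: inverse_one_minus[OF order_ge_Y_mult] mps_of_int_hom)
  then have "mps_of_int (mps_geo ?u) = (mps_geo (mps_of_int ?u) :: (var, 'a) mps)"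
    by (simp only: u inverse_one_minus[OF order_ge_Y_mult])
  then show ?thesis
    unfolding xqy_factor_def by (simp only: u mps_of_int_hom split: if_splits) simp
qed

lemma xqy_factor_over: "(xqy_factor r s j k :: (var, 'a::comm_ring_1) mps) \<in> mps_over (vars r s)"
proof -
  have "(Y * xq_monomial r s j k :: (var, 'a) mps) \<in> mps_over (vars r s)"
    unfolding xq_monomial_def
    by (intro mps_over_mult mps_over_prod mps_over_power mps_over_var) (auto simp: vars_def)
  then show ?thesis
    unfolding xqy_factor_def by (auto intro: mps_over_geo order_ge_Y_mult mps_over_diff mps_over_one)
qed

text \<open>A large exponent of a single \<open>Q i\<close> pushes the monomial, and with it the
  deviation of the factor from 1, beyond degree \<open>N\<close>. This is what makes the product
  converge.\<close>

lemma xqy_factor_eq_upto_1: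
  assumes "i \<in> {1..s}" "k i > N"
  shows "eq_upto N (xqy_factor r s j k) (1 :: (var, 'a::comm_ring_1) mps)"
proof -
  let ?u = "Y * xq_monomial r s j k :: (var, 'a) mps"
  have "?u = Q i ^ k i *
      (Y * (\<Prod>i = 1..r. X i ^ j i) * (\<Prod>i\<in>{1..s} - {i}. Q i ^ k i))"
    using prod.remove[OF _ assms(1), of "\<lambda>i. Q i ^ k i :: (var, 'a) mps"]
    by (simp add: xq_monomial_def mult_ac)
  then have "order_ge (k i) ?u"
    by (simp add: order_ge_mult_left order_ge_var_power)
  then have u: "eq_upto N ?u 0" using assms(2) by (rule order_ge_imp_eq_upto)
  have "eq_upto N (1 + ?u * mps_geo ?u) (1 + 0 * mps_geo ?u)"
    by (intro eq_upto_add eq_upto_mult u eq_upto_refl)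
  then have "eq_upto N (mps_geo ?u) 1"
    by (simp flip: mps_geo_unfold[OF order_ge_Y_mult])
  moreover have "eq_upto N (1 - ?u) (1 - 0)"
    by (intro eq_upto_diff u eq_upto_refl)
  ultimately show ?thesis by (simp add: xqy_factor_def)
qed

lemma xqy_factor_multipliable:
  "multipliable_on (xqy_factor r s j :: _ \<Rightarrow> (var, 'a::comm_ring_1) mps) ({1..s} \<rightarrow>\<^sub>E UNIV)"
  "eq_upto N (infprod (xqy_factor r s j) ({1..s} \<rightarrow>\<^sub>E UNIV))
     (\<Prod>k\<in>{1..s} \<rightarrow>\<^sub>E {..N}. xqy_factor r s j k :: (var, 'a) mps)"
proof -
  have small: "eq_upto N (xqy_factor r s j k) (1 :: (var, 'a) mps)"
    if "k \<in> ({1..s} \<rightarrow>\<^sub>E UNIV) - ({1..s} \<rightarrow>\<^sub>E {..N})" for k N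
  proof -
    from that obtain i where "i \<in> {1..s}" "k i > N"
      by (auto simp: PiE_iff not_le)
    then show ?thesis by (rule xqy_factor_eq_upto_1)
  qed
  have fin: "finite ({1..s} \<rightarrow>\<^sub>E {..N})" "({1..s} \<rightarrow>\<^sub>E {..N}) \<subseteq> ({1..s} \<rightarrow>\<^sub>E UNIV)" for N :: nat
    by (auto intro: finite_PiE)
  show "multipliable_on (xqy_factor r s j :: _ \<Rightarrow> (var, 'a) mps) ({1..s} \<rightarrow>\<^sub>E UNIV)"
    by (rule multipliable_mps(1)[OF fin small])
  show "eq_upto N (infprod (xqy_factor r s j) ({1..s} \<rightarrow>\<^sub>E UNIV))
     (\<Prod>k\<in>{1..s} \<rightarrow>\<^sub>E {..N}. xqy_factor r s j k :: (var, 'a) mps)"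
    by (rule multipliable_mps(2)[OF fin small])
qed

text \<open>The monomial \<open>u\<close> is linear in \<open>Y\<close>, so \<open>1 - u\<close> and
  its inverse have logarithmic derivatives \<open>- u / (1 - u)\<close> and
  \<open>u / (1 - u)\<close>.\<close>

lemma euler_deriv_xqy_factor:
  fixes r s j k
  defines "u \<equiv> Y * xq_monomial r s j k :: (var, 'a::comm_ring_1) mps"
  shows "euler_deriv VarY (xqy_factor r s j k) =
    xqy_factor r s j k * ((-1) ^ (\<Sum>i = 1..r. j i) * (u * mps_geo u))"
proof -
  have "euler_deriv VarY (xq_monomial r s j k :: (var, 'a) mps) = 0"
    unfolding xq_monomial_def
    by (simp add: euler_deriv_mult euler_deriv_prod_eq_0 euler_deriv_power_eq_0 euler_deriv_var)
  then have u: "euler_deriv VarY u = u"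
    by (simp add: u_def euler_deriv_mult euler_deriv_var)
  have geo: "(1 - u) * mps_geo u = 1"
    unfolding u_def by (rule mps_geo_inverse[OF order_ge_Y_mult])
  have "(1 - u) * euler_deriv VarY (mps_geo u) = u * mps_geo u"
    using arg_cong[OF geo, of "euler_deriv VarY"] by (simp add: euler_deriv_mult u)
  then have "mps_geo u * ((1 - u) * euler_deriv VarY (mps_geo u)) = mps_geo u * (u * mps_geo u)"
    by simp
  then have "((1 - u) * mps_geo u) * euler_deriv VarY (mps_geo u) = mps_geo u * (u * mps_geo u)"
    by (simp only: mult_ac)
  then have dgeo: "euler_deriv VarY (mps_geo u) = mps_geo u * (u * mps_geo u)"
    by (simp add: geo)
  have "(1 - u) * (u * mps_geo u) = u * ((1 - u) * mps_geo u)"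
    by (simp only: mult_ac)
  also have "\<dots> = u" by (simp only: geo mult_1_right)
  finally have "euler_deriv VarY (1 - u) = (1 - u) * (- (u * mps_geo u))"
    by (simp add: u)
  with dgeo show ?thesis
    unfolding xqy_factor_def u_def[symmetric] by auto
qed

text \<open>Being congruent to 1 modulo \<open>v\<close> is stable under products; with
  \<open>Y\<close> for \<open>v\<close> this yields the value of the product at
  \<open>y = 0\<close>.\<close>

lemma var_dvd_prod_minus_one:
  fixes f :: "'i \<Rightarrow> ('v, 'a::comm_ring_1) mps"
  assumes "\<And>i. i \<in> A \<Longrightarrow> v dvd f i - 1"
  shows "v dvd prod f A - 1"
  using assms
proof (induction A rule: infinite_finite_induct)
  case (insert i A)
  have "prod f (insert i A) - 1 = (f i - 1) * prod f A + (prod f A - 1)"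
    using insert.hyps by (simp add: algebra_simps)
  moreover have "v dvd (f i - 1) * prod f A"
    using insert.prems by (intro dvd_mult2) auto
  ultimately show ?case using insert by (simp only: dvd_add insertI2)
qed simp_all

lemma Y_dvd_xqy_factor_minus_one: "Y dvd xqy_factor r s j k - (1 :: (var, 'a::comm_ring_1) mps)"
proof -
  let ?u = "Y * xq_monomial r s j k :: (var, 'a) mps"
  have "mps_geo ?u - 1 = ?u * mps_geo ?u"
    using mps_geo_unfold[OF order_ge_Y_mult, of "xq_monomial r s j k"] by (simp add: algebra_simps)
  then have "Y dvd mps_geo ?u - 1" by (simp add: mult.assoc)
  then show ?thesis by (simp add: xqy_factor_def)
qed


section \<open>Power sums\<close>

definition xq_power_sum :: "nat \<Rightarrow> nat \<Rightarrow> nat \<Rightarrow> (var, 'a::comm_ring_1) mps" where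
  "xq_power_sum r s n = (\<Prod>j = 1..r. 1 - X j ^ n) * inverse (\<Prod>k = 1..s. 1 - Q k ^ n)"

lemma order_ge_Q_power: "n > 0 \<Longrightarrow> order_ge 1 (Q k ^ n :: (var, 'a::comm_ring_1) mps)"
  by (rule order_ge_mono[OF order_ge_var_power]) simp

text \<open>Expand each \<open>1 - X i ^ n\<close> over the exponents 0 and 1 and each
  \<open>1 / (1 - Q i ^ n)\<close> as a geometric series cut at \<open>N\<close>, then distribute.
  Positivity of \<open>n\<close> keeps \<open>Q i ^ n\<close> free of a constant term.\<close>

lemma xq_power_sum_eq_upto:
  assumes "n > 0"
  shows "eq_upto N
    (\<Sum>(j, k)\<in>({1..r} \<rightarrow>\<^sub>E {0, 1}) \<times> ({1..s} \<rightarrow>\<^sub>E {..N}).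
      (-1) ^ (\<Sum>i = 1..r. j i) * xq_monomial r s j k ^ n)
    (xq_power_sum r s n :: (var, 'a::comm_ring_1) mps)"
proof -
  let ?J = "{1..r} \<rightarrow>\<^sub>E {0, 1 :: nat}" and ?K = "{1..s} \<rightarrow>\<^sub>E {..N}"
  have pow: "(\<Prod>i = 1..l. v i ^ t i) ^ n = (\<Prod>i = 1..l. (v i ^ n) ^ t i)"
    for v :: "nat \<Rightarrow> (var, 'a) mps" and t l
    by (simp add: prod_power_distrib mult.commute flip: power_mult)
  have "(\<Sum>(j, k)\<in>?J \<times> ?K. (-1) ^ (\<Sum>i = 1..r. j i) * xq_monomial r s j k ^ n) =
      (\<Sum>j\<in>?J. \<Sum>k\<in>?K. (\<Prod>i = 1..r. (-1) ^ j i * (X i ^ n) ^ j i) *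
        (\<Prod>i = 1..s. (Q i ^ n) ^ k i) :: (var, 'a) mps)"
    unfolding sum.cartesian_product[symmetric]
    by (simp only: xq_monomial_def power_mult_distrib pow power_sum prod.distrib mult.assoc)
  also have "\<dots> = (\<Sum>j\<in>?J. \<Prod>i = 1..r. (-1) ^ j i * (X i ^ n) ^ j i) *
      (\<Sum>k\<in>?K. \<Prod>i = 1..s. (Q i ^ n) ^ k i)"
    by (rule sum_product[symmetric])
  also have "(\<Sum>j\<in>?J. \<Prod>i = 1..r. (-1) ^ j i * (X i ^ n) ^ j i) =
      (\<Prod>i = 1..r. \<Sum>t\<in>{0, 1}. (-1) ^ t * (X i ^ n) ^ t :: (var, 'a) mps)"
    by (rule prod_sum_PiE[symmetric]) auto
  also have "\<dots> = (\<Prod>i = 1..r. 1 - X i ^ n)"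
    by simp
  also have "(\<Sum>k\<in>?K. \<Prod>i = 1..s. (Q i ^ n) ^ k i) =
      (\<Prod>i = 1..s. \<Sum>t\<le>N. (Q i ^ n) ^ t :: (var, 'a) mps)"
    by (rule prod_sum_PiE[symmetric]) auto
  finally have eq: "(\<Sum>(j, k)\<in>?J \<times> ?K. (-1) ^ (\<Sum>i = 1..r. j i) * xq_monomial r s j k ^ n) =
      (\<Prod>i = 1..r. 1 - X i ^ n) * (\<Prod>i = 1..s. \<Sum>t\<le>N. (Q i ^ n) ^ t :: (var, 'a) mps)" .
  have "eq_upto N (\<Prod>i = 1..s. \<Sum>t\<le>N. (Q i ^ n) ^ t) (\<Prod>i = 1..s. mps_geo (Q i ^ n :: (var, 'a) mps))"
    by (intro eq_upto_prod eq_upto_sym[OF mps_geo_eq_upto] order_ge_Q_power assms)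
  also have "(\<Prod>i = 1..s. mps_geo (Q i ^ n :: (var, 'a) mps)) = inverse (\<Prod>i = 1..s. 1 - Q i ^ n)"
    unfolding mps_inverse_prod
    by (intro prod.cong refl inverse_one_minus[symmetric] order_ge_Q_power assms)
  finally show ?thesis
    unfolding eq xq_power_sum_def by (intro eq_upto_mult eq_upto_refl)
qed

lemma euler_deriv_xq_power_sum: "euler_deriv VarY (xq_power_sum r s n) = 0"
  unfolding xq_power_sum_def
  by (simp add: euler_deriv_mult euler_deriv_prod_eq_0 euler_deriv_power_eq_0 euler_deriv_var
      euler_deriv_inverse_eq_0)

text \<open>The shifted index leaves one factor \<open>Y\<close> outside, the shape that
  \<open>euler_deriv_unique\<close> asks for.\<close>

definition power_sum_series :: "nat \<Rightarrow> nat \<Rightarrow> nat \<Rightarrow> (var, 'a::comm_ring_1) mps" where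
  "power_sum_series r s N = (\<Sum>n\<le>N. xq_power_sum r s (Suc n) * Y ^ n)"

text \<open>Add the logarithmic derivatives of the factors, expand them geometrically and exchange
  the sums: the power \<open>Y ^ Suc n\<close> collects the signed powers of all monomials, which is
  a power sum.\<close>

lemma euler_deriv_product:
  fixes r s N
  defines "F \<equiv> \<Prod>(j, k)\<in>({1..r} \<rightarrow>\<^sub>E {0, 1}) \<times> ({1..s} \<rightarrow>\<^sub>E {..N}).
    xqy_factor r s j k :: (var, 'a::comm_ring_1) mps"
  shows "eq_upto N (euler_deriv VarY F) (F * (Y * power_sum_series r s N))"
proof -
  let ?C = "({1..r} \<rightarrow>\<^sub>E {0, 1 :: nat}) \<times> ({1..s} \<rightarrow>\<^sub>E {..N})"
  define u :: "_ \<Rightarrow> _ \<Rightarrow> (var, 'a) mps" where "u j k = Y * xq_monomial r s j k" for j k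
  define \<epsilon> :: "_ \<Rightarrow> (var, 'a) mps" where "\<epsilon> j = (-1) ^ (\<Sum>i = 1..r. j i)" for j :: "nat \<Rightarrow> nat"
  have fin: "finite ?C" by (auto intro: finite_PiE)
  have dF: "euler_deriv VarY F = F * (\<Sum>(j, k)\<in>?C. \<epsilon> j * (u j k * mps_geo (u j k)))"
    unfolding F_def
    by (rule euler_deriv_prod_log[OF _ fin])
      (auto simp: euler_deriv_xqy_factor u_def \<epsilon>_def simp del: insert_iff)
  have "eq_upto N (\<Sum>(j, k)\<in>?C. \<epsilon> j * (u j k * mps_geo (u j k)))
      (\<Sum>(j, k)\<in>?C. \<epsilon> j * (u j k * (\<Sum>n\<le>N. u j k ^ n)))"
    unfolding case_prod_beta
    by (intro eq_upto_sum eq_upto_mult eq_upto_refl mps_geo_eq_upto)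
      (simp only: u_def order_ge_Y_mult)
  also have "(\<Sum>(j, k)\<in>?C. \<epsilon> j * (u j k * (\<Sum>n\<le>N. u j k ^ n))) =
      Y * (\<Sum>n\<le>N. (\<Sum>(j, k)\<in>?C. \<epsilon> j * xq_monomial r s j k ^ Suc n) * Y ^ n)"
  proof -
    have "(\<Sum>(j, k)\<in>?C. \<epsilon> j * (u j k * (\<Sum>n\<le>N. u j k ^ n))) =
        (\<Sum>c\<in>?C. \<Sum>n\<le>N. \<epsilon> (fst c) * u (fst c) (snd c) ^ Suc n)"
      by (simp only: case_prod_unfold sum_distrib_left power_Suc)
    also have "\<dots> = (\<Sum>n\<le>N. \<Sum>c\<in>?C. \<epsilon> (fst c) * u (fst c) (snd c) ^ Suc n)"
      by (rule sum.swap)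
    also have "\<dots> = (\<Sum>n\<le>N. Y * ((\<Sum>(j, k)\<in>?C. \<epsilon> j * xq_monomial r s j k ^ Suc n) * Y ^ n))"
    proof (rule sum.cong[OF refl])
      fix n
      have "\<epsilon> j * u j k ^ Suc n = Y ^ Suc n * (\<epsilon> j * xq_monomial r s j k ^ Suc n)" for j k
        by (simp only: u_def power_mult_distrib mult_ac)
      then have "(\<Sum>c\<in>?C. \<epsilon> (fst c) * u (fst c) (snd c) ^ Suc n) =
          Y ^ Suc n * (\<Sum>(j, k)\<in>?C. \<epsilon> j * xq_monomial r s j k ^ Suc n)"
        by (simp only: case_prod_unfold sum_distrib_left)
      also have "\<dots> = Y * ((\<Sum>(j, k)\<in>?C. \<epsilon> j * xq_monomial r s j k ^ Suc n) * Y ^ n)"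
        by (simp only: power_Suc mult_ac)
      finally show "(\<Sum>c\<in>?C. \<epsilon> (fst c) * u (fst c) (snd c) ^ Suc n) =
          Y * ((\<Sum>(j, k)\<in>?C. \<epsilon> j * xq_monomial r s j k ^ Suc n) * Y ^ n)" .
    qed
    finally show ?thesis by (simp only: sum_distrib_left)
  qed
  also have "eq_upto N \<dots> (Y * power_sum_series r s N)"
    unfolding power_sum_series_def \<epsilon>_def
    by (intro eq_upto_mult eq_upto_sum eq_upto_refl xq_power_sum_eq_upto) simp
  finally show ?thesis
    unfolding dF by (intro eq_upto_mult eq_upto_refl)
qed


section \<open>The averages over the symmetric groups\<close>

text \<open>The recursion is the differential equation read off at each power of \<open>v\<close>;
  only the truncation of the series needs care.\<close>

lemma euler_deriv_newton_series:
  fixes a p :: "nat \<Rightarrow> ('v, rat) mps"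
  assumes rec: "\<And>n. of_nat (Suc n) * a (Suc n) = (\<Sum>i\<le>n. p (Suc i) * a (n - i))"
    and a0: "a 0 = 1"
    and p: "\<And>n. euler_deriv v (p n) = 0"
  shows "eq_upto N (euler_deriv v (\<Sum>n\<le>N. a n * mps_var v ^ n))
    ((\<Sum>n\<le>N. a n * mps_var v ^ n) * (mps_var v * (\<Sum>n\<le>N. p (Suc n) * mps_var v ^ n)))"
proof -
  let ?y = "mps_var v :: ('v, rat) mps"
  \<comment> \<open>The recursion keeps \<open>a\<close> free of \<open>v\<close>; the factor
    \<open>Suc m\<close> is cancelled over the rationals.\<close>
  have a: "euler_deriv v (a n) = 0" for n
  proof (induction n rule: less_induct)
    case (less n)
    show ?case
    proof (cases n)
      case (Suc m)
      have "of_nat (Suc m) * euler_deriv v (a (Suc m)) = euler_deriv v (of_nat (Suc m) * a (Suc m))"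
        by (simp add: euler_deriv_mult del: of_nat_Suc)
      also have "\<dots> = (\<Sum>i\<le>m. euler_deriv v (p (Suc i) * a (m - i)))"
        by (simp only: rec euler_deriv_sum)
      also have "\<dots> = 0"
        by (rule sum.neutral) (simp add: euler_deriv_mult p less Suc)
      finally show ?thesis using Suc of_nat_mps_mult_eq_0[of "Suc m"] by blast
    qed (simp add: a0)
  qed
  have "euler_deriv v (\<Sum>n\<le>N. a n * ?y ^ n) = (\<Sum>n\<le>N. of_nat n * (a n * ?y ^ n))"
    by (simp add: euler_deriv_sum euler_deriv_mult_var_power a)
  \<comment> \<open>The term for \<open>n = 0\<close> vanishes; shifting the index exposes the left
    side of \<open>rec\<close>.\<close>
  also have "\<dots> = (\<Sum>n<N. of_nat (Suc n) * (a (Suc n) * ?y ^ Suc n))"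
    by (simp only: lessThan_Suc_atMost[symmetric] sum.lessThan_Suc_shift) simp
  also have "\<dots> = (\<Sum>n<N. \<Sum>i\<le>n. (p (Suc i) * ?y ^ i) * (a (n - i) * ?y ^ (n - i)) * ?y)"
  proof (rule sum.cong[OF refl])
    fix n
    have "of_nat (Suc n) * (a (Suc n) * ?y ^ Suc n) = (of_nat (Suc n) * a (Suc n)) * ?y ^ Suc n"
      by (simp only: mult_ac)
    also have "\<dots> = (\<Sum>i\<le>n. (p (Suc i) * ?y ^ i) * (a (n - i) * ?y ^ (n - i)) * ?y)"
      unfolding rec sum_distrib_right
    proof (rule sum.cong[OF refl])
      fix i assume "i \<in> {..n}"
      then have "?y ^ Suc n = ?y ^ i * ?y ^ (n - i) * ?y"
        by (simp flip: power_add)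
      then show "p (Suc i) * a (n - i) * ?y ^ Suc n =
          (p (Suc i) * ?y ^ i) * (a (n - i) * ?y ^ (n - i)) * ?y"
        by (simp only: mult_ac)
    qed
    finally show "of_nat (Suc n) * (a (Suc n) * ?y ^ Suc n) =
        (\<Sum>i\<le>n. (p (Suc i) * ?y ^ i) * (a (n - i) * ?y ^ (n - i)) * ?y)" .
  qed
  also have "\<dots> = (\<Sum>(i, n)\<in>{(i, n). i + n < N}. (p (Suc i) * ?y ^ i) * (a n * ?y ^ n) * ?y)"
    by (rule sum.triangle_reindex[symmetric])
  \<comment> \<open>The missing pairs have \<open>i + n\<close> at least \<open>N\<close>, and the
    extra factor \<open>?y\<close> lifts their terms to order above \<open>N\<close>. So the
    triangle may be completed to a square, which factors.\<close>
  also have "eq_upto N \<dots> (\<Sum>(i, n)\<in>{..N} \<times> {..N}. (p (Suc i) * ?y ^ i) * (a n * ?y ^ n) * ?y)"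
  proof (rule eq_upto_sym, rule eq_upto_sum_subset)
    fix t assume "t \<in> {..N} \<times> {..N} - {(i, n). i + n < N}"
    then obtain i n where t: "t = (i, n)" "N < Suc (i + n)" by auto
    have "(p (Suc i) * ?y ^ i) * (a n * ?y ^ n) * ?y = ?y ^ Suc (i + n) * (p (Suc i) * a n)"
      by (simp add: power_add mult_ac)
    moreover have "order_ge (Suc (i + n)) (?y ^ Suc (i + n) * (p (Suc i) * a n))"
      by (intro order_ge_mult_left order_ge_var_power)
    ultimately show "eq_upto N
        (case t of (i, n) \<Rightarrow> (p (Suc i) * ?y ^ i) * (a n * ?y ^ n) * ?y) 0"
      using t by (simp only: prod.case) (rule order_ge_imp_eq_upto)
  qed auto
  also have "(\<Sum>(i, n)\<in>{..N} \<times> {..N}. (p (Suc i) * ?y ^ i) * (a n * ?y ^ n) * ?y) =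
      (\<Sum>n\<le>N. p (Suc n) * ?y ^ n) * (\<Sum>n\<le>N. a n * ?y ^ n) * ?y"
    by (simp only: sum_product sum.cartesian_product[symmetric]) (simp only: sum_distrib_right)
  finally show ?thesis by (simp only: mult_ac)
qed

definition det_quotient ::
    "nat \<Rightarrow> nat \<Rightarrow> nat \<Rightarrow> (nat \<Rightarrow> nat) \<Rightarrow> (nat \<Rightarrow> nat) \<Rightarrow> (var, 'a::comm_ring_1) mps" where
  "det_quotient r s n \<sigma> e =
     (\<Prod>j = 1..r. weighted_det n \<sigma> e (X j)) * inverse (\<Prod>k = 1..s. weighted_det n \<sigma> e (Q k))"

definition det_average :: "nat \<Rightarrow> nat \<Rightarrow> nat \<Rightarrow> (var, rat) mps" where
  "det_average r s n =
     inverse (of_nat (fact n)) * (\<Sum>\<sigma> | \<sigma> permutes {0..<n}. det_quotient r s n \<sigma> (\<lambda>_. 1))"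

lemma det_average_0: "det_average r s 0 = 1"
  by (simp add: det_average_def det_quotient_def)

lemma det_average_recursion:
  "of_nat (Suc n) * det_average r s (Suc n) =
     (\<Sum>i\<le>n. xq_power_sum r s (Suc i) * det_average r s (n - i))"
  unfolding det_average_def
proof (rule permutation_sum_recursion)
  fix n :: nat and q and e :: "nat \<Rightarrow> nat"
  assume q: "q permutes {0..<n}"
  show "det_quotient r s (Suc n) q e =
      xq_power_sum r s (e n) * (det_quotient r s n q e :: (var, rat) mps)"
    by (simp add: det_quotient_def xq_power_sum_def weighted_det_fixed[OF q] prod.distrib
        mps_inverse_mult mult_ac)
  show "det_quotient r s (Suc n) (transpose n b \<circ> q) e =
      (det_quotient r s n q (e(b := e b + e n)) :: (var, rat) mps)" if "b < n" for b
    by (simp add: det_quotient_def weighted_det_skip[OF q that])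
  show "det_quotient r s n (transpose a b \<circ> q \<circ> transpose a b) (e \<circ> transpose a b) =
      (det_quotient r s n q e :: (var, rat) mps)" if "a < n" "b < n" for a b
    by (simp add: det_quotient_def weighted_det_conj[OF that q])
next
  fix n :: nat and q and e e' :: "nat \<Rightarrow> nat"
  assume "\<And>i. i < n \<Longrightarrow> e i = e' i"
  then have "weighted_det n q e x = weighted_det n q e' x" for x :: "(var, rat) mps"
    unfolding weighted_det_def by (intro arg_cong[where f = det] eq_matI) auto
  then show "det_quotient r s n q e = (det_quotient r s n q e' :: (var, rat) mps)"
    by (simp add: det_quotient_def)
next
  \<comment> \<open>The normalising scalars of the recursion are the inverse factorials.\<close>
  show "inverse (of_nat (fact 0)) = (1 :: (var, rat) mps)" by simp
  show "of_nat (Suc n) * inverse (of_nat (fact (Suc n))) =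
      (inverse (of_nat (fact n)) :: (var, rat) mps)" for n
  proof -
    have "of_nat (Suc n) * inverse (of_nat (fact (Suc n))) =
        (of_nat (Suc n) * inverse (of_nat (Suc n))) * inverse (of_nat (fact n) :: (var, rat) mps)"
      by (simp only: fact_Suc of_nat_mult of_nat_id mps_inverse_mult mult_ac)
    also have "of_nat (Suc n) * inverse (of_nat (Suc n)) = (1 :: (var, rat) mps)"
      by (rule of_nat_mps_inverse) simp
    finally show ?thesis by simp
  qed
qed

text \<open>Both sides satisfy the same linear equation up to degree \<open>N\<close> and agree at
  \<open>y = 0\<close>.\<close>

lemma det_average_series_eq_upto:
  "eq_upto N (\<Sum>n\<le>N. det_average r s n * Y ^ n)
    (\<Prod>(j, k)\<in>({1..r} \<rightarrow>\<^sub>E {0, 1}) \<times> ({1..s} \<rightarrow>\<^sub>E {..N}). xqy_factor r s j k)"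
    (is "eq_upto N ?E ?F")
proof (rule euler_deriv_unique)
  show "eq_upto N (euler_deriv VarY ?E) (?E * (Y * power_sum_series r s N))"
    unfolding power_sum_series_def
    by (rule euler_deriv_newton_series)
      (simp_all only: det_average_recursion det_average_0 euler_deriv_xq_power_sum)
  show "eq_upto N (euler_deriv VarY ?F) (?F * (Y * power_sum_series r s N))"
    by (rule euler_deriv_product)
  fix m :: "var multiset"
  assume m: "VarY \<notin># m"
  \<comment> \<open>Agreement at \<open>y = 0\<close> is obtained by showing that both sides are 1
    modulo \<open>Y\<close>.\<close>
  have "Y dvd ?F - 1"
    by (rule var_dvd_prod_minus_one) (auto simp: Y_dvd_xqy_factor_minus_one)
  moreover have "?E - 1 = (\<Sum>n<N. det_average r s (Suc n) * Y ^ Suc n)"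
    by (simp only: lessThan_Suc_atMost[symmetric] sum.lessThan_Suc_shift) (simp add: det_average_0)
  then have "Y dvd ?E - 1"
    by (auto intro!: dvd_sum)
  ultimately have "Y dvd (?E - 1) - (?F - 1)"
    by (rule dvd_diff[rotated])
  then have "Y dvd ?E - ?F" by simp
  then obtain g where "?E - ?F = Y * g" ..
  then have "mps_coeff (?E - ?F) m = 0"
    using mps_coeff_var_mult[OF m, of g] by simp
  then show "mps_coeff ?E m = mps_coeff ?F m" by simp
qed

theorem theorem1p2:
  fixes r s :: nat
  defines "summand \<equiv> \<lambda>n. (Y :: (var, rat) mps) ^ n / of_nat (fact n) *
      (\<Sum>\<sigma> | \<sigma> permutes {0..<n}.
        (\<Prod>j = 1..r. det (1\<^sub>m n - X j \<cdot>\<^sub>m perm_matrix n \<sigma>)) /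
        (\<Prod>k = 1..s. det (1\<^sub>m n - Q k \<cdot>\<^sub>m perm_matrix n \<sigma>)))"
    and "factor \<equiv> \<lambda>j k.
      (1 - (Y :: (var, int) mps) * (\<Prod>i = 1..r. X i ^ j i) * (\<Prod>i = 1..s. Q i ^ k i))
        powi ((-1) ^ ((\<Sum>i = 1..r. j i) + 1))"
  defines "RHS \<equiv> (\<Prod>j \<in> {1..r} \<rightarrow>\<^sub>E {0, 1 :: nat}. infprod (factor j) ({1..s} \<rightarrow>\<^sub>E (UNIV :: nat set)))"
  shows "summand summable_on {1..} \<and>
    (\<forall>j \<in> {1..r} \<rightarrow>\<^sub>E {0, 1}. multipliable_on (factor j) ({1..s} \<rightarrow>\<^sub>E UNIV)) \<and>
    RHS \<in> mps_over (vars r s) \<and>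
    1 + (\<Sum>\<^sub>\<infinity>n\<in>{1..}. summand n) = mps_of_int RHS"
proof (intro conjI)
  have factor: "factor = xqy_factor r s"
    unfolding factor_def by (intro ext) (rule xqy_factor_powi)
  have summand: "summand = (\<lambda>n. det_average r s n * Y ^ n)"
    unfolding summand_def det_average_def det_quotient_def det_one_minus_perm_matrix divide_mps_def
    by (simp only: mult_ac)
  \<comment> \<open>Finite box products approximate the right side: exponents of \<open>q\<close>
    above \<open>N\<close> do not matter up to degree \<open>N\<close>.\<close>
  let ?F = "\<lambda>N. \<Prod>(j, k)\<in>({1..r} \<rightarrow>\<^sub>E {0, 1}) \<times> ({1..s} \<rightarrow>\<^sub>E {..N}). xqy_factor r s j k"
  have RHS: "eq_upto N RHS (?F N)" for N
    unfolding RHS_def factor prod.cartesian_product[symmetric]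
    by (intro eq_upto_prod xqy_factor_multipliable(2))
  have small: "eq_upto N (summand n) 0" if "n \<in> {1..} - {1..N}" for n N
    using order_ge_mult_left[OF order_ge_var_power, of n VarY "det_average r s n"] that
    by (auto simp: summand mult.commute intro: order_ge_imp_eq_upto)
  obtain S where S: "(summand has_sum S) {1..}" "\<And>N. eq_upto N S (sum summand {1..N})"
    by (rule has_sum_mps[of "\<lambda>N. {1..N}" "{1..}" summand]) (use small in auto)
  then show "summand summable_on {1..}" by (auto simp: summable_on_def)
  show "\<forall>j \<in> {1..r} \<rightarrow>\<^sub>E {0, 1}. multipliable_on (factor j) ({1..s} \<rightarrow>\<^sub>E UNIV)"
    unfolding factor by (intro ballI xqy_factor_multipliable(1))
  show "RHS \<in> mps_over (vars r s)"
    by (rule mps_over_limit[OF RHS]) (auto intro!: mps_over_prod xqy_factor_over)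
  have "1 + S = mps_of_int RHS"
  proof (rule eq_upto_imp_eq)
    fix N
    have "eq_upto N (1 + S) (1 + sum summand {1..N})"
      by (intro eq_upto_add eq_upto_refl S(2))
    also have "1 + sum summand {1..N} = (\<Sum>n\<le>N. det_average r s n * Y ^ n)"
      by (simp add: summand det_average_0 atMost_atLeast0 sum.atLeast_Suc_atMost)
    also have "eq_upto N \<dots> (?F N)"
      by (rule det_average_series_eq_upto)
    \<comment> \<open>Each factor is already defined over the integers; this transfers the rational
      identity to the integral product.\<close>
    also have "?F N = mps_of_int (?F N)"
      by (simp add: case_prod_beta xqy_factor_of_int)
    also have "eq_upto N \<dots> (mps_of_int RHS)"
      by (rule mps_of_int_eq_upto[OF eq_upto_sym[OF RHS]])
    finally show "eq_upto N (1 + S) (mps_of_int RHS)" .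
  qed
  with S(1) show "1 + (\<Sum>\<^sub>\<infinity>n\<in>{1..}. summand n) = mps_of_int RHS"
    by (simp add: infsumI)
qed

end
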